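(* Let $\mathbf{a}=[\alpha_1,\dots,\alpha_{N+1}]$ be a list of positive integers whose greatest common divisor is $1$, and suppose some sublist of $\mathbf{a}$ has greatest common divisor different from $1$. Let $\ell$ be the greatest integer for which there exists a set $J\subseteq\{1,\dots,N+1\}$ with $|J|=\ell$ such that $\gcd\{\alpha_j: j\in J\}\neq 1$. Write $E(\mathbf{a})(t)=\sum_{i=0}^N E_i(t)t^i$ with $E_i$ periodic. Then for every $m\ge \ell$ the coefficient $E_m(t)$ is a constant function of $t$, while the coefficient $E_{\ell-1}(t)$ is not constant (it is strictly periodic). Moreover, if the numbers $\alpha_i$ are given together with their prime factorizations, then $\ell$ can be determined in polynomial time.
   Context: $E(\mathbf{a})(t)$ denotes the number of solutions $(x_1,\dots,x_{N+1})\in\mathbb{Z}_{\ge0}^{N+1}$ of $\sum_{i}\alpha_ix_i=t$ for non-negative integers $t$; it is a quasi-polynomial $\sum_{i=0}^N E_i(t)t^i$ in $t$ with periodic coefficient functions $E_i$. *)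

theory Defs
  imports
    "HOL-Computational_Algebra.Primes"
    "HOL-Computational_Algebra.Polynomial"
    "HOL-Library.Sublist"
begin

section \<open>The denumerant and its quasi-polynomial coefficients\<close>

text \<open>
  A list \<open>as = [\<alpha>\<^sub>1, \<dots>, \<alpha>\<^bsub>N+1\<^esub>]\<close> has \<open>N = length as - 1\<close>; indices are shifted to start at 0.
\<close>

definition denumerant :: "nat list \<Rightarrow> nat \<Rightarrow> nat" where
  "denumerant as t =
     card {xs :: nat list. length xs = length as \<and> (\<Sum>i<length as. as ! i * xs ! i) = t}"

definition periodic :: "(nat \<Rightarrow> 'a) \<Rightarrow> bool" where
  "periodic f \<longleftrightarrow> (\<exists>q>0. \<forall>t. f (t + q) = f t)"

definition constant_fun :: "(nat \<Rightarrow> 'a) \<Rightarrow> bool" where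
  "constant_fun f \<longleftrightarrow> (\<exists>c. \<forall>t. f t = c)"

text \<open>Only the values \<open>E i\<close> with \<open>i \<le> N\<close> are relevant.\<close>

definition denumerant_coeffs :: "nat list \<Rightarrow> (nat \<Rightarrow> nat \<Rightarrow> real) \<Rightarrow> bool" where
  "denumerant_coeffs as E \<longleftrightarrow>
     (\<forall>i\<le>length as - 1. periodic (E i)) \<and>
     (\<forall>t. real (denumerant as t) = (\<Sum>i\<le>length as - 1. E i t * real t ^ i))"

text \<open>
  Sublists and index sets are required to be nonempty, because in the library
  \<open>Gcd {} = 0 \<noteq> 1\<close>.
\<close>

definition admissible :: "nat list \<Rightarrow> bool" where
  "admissible as \<longleftrightarrow>
     (\<forall>a\<in>set as. 0 < a) \<and> Gcd (set as) = 1 \<and>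
     (\<exists>bs. subseq bs as \<and> bs \<noteq> [] \<and> Gcd (set bs) \<noteq> 1)"

definition ell :: "nat list \<Rightarrow> nat" where
  "ell as = Max {card J |J. J \<subseteq> {..<length as} \<and> J \<noteq> {} \<and> Gcd ((\<lambda>j. as ! j) ` J) \<noteq> 1}"


section \<open>Polynomial time on multi-tape Turing machines\<close>

text \<open>
  Deterministic machines with finitely many two-way infinite tapes. Tape symbols are the
  numbers below \<open>symbols M\<close>, with 0 the blank. The working states are the numbers below
  \<open>states M\<close>, with 0 the initial state; the number \<open>states M\<close> itself is the halting state.
\<close>

datatype move = Left | Stay | Right

record tm =
  tapes :: nat
  states :: nat
  symbols :: nat
  delta :: "nat \<Rightarrow> nat list \<Rightarrow> nat \<times> (nat \<times> move) list"

definition wf_tm :: "tm \<Rightarrow> bool" where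
  "wf_tm M \<longleftrightarrow> 2 \<le> tapes M \<and> 0 < states M \<and> 0 < symbols M \<and>
     (\<forall>q < states M. \<forall>ss. length ss = tapes M \<and> set ss \<subseteq> {..<symbols M} \<longrightarrow>
        (case delta M q ss of (q', acts) \<Rightarrow>
           q' \<le> states M \<and> length acts = tapes M \<and> fst ` set acts \<subseteq> {..<symbols M}))"

text \<open>Cell contents and head position.\<close>

type_synonym tape = "(int \<Rightarrow> nat) \<times> int"
type_synonym config = "nat \<times> tape list"

fun head_offset :: "move \<Rightarrow> int" where
  "head_offset Left = -1"
| "head_offset Stay = 0"
| "head_offset Right = 1"

fun read :: "tape \<Rightarrow> nat" where
  "read (c, h) = c h"

fun act :: "nat \<times> move \<Rightarrow> tape \<Rightarrow> tape" where
  "act (s, m) (c, h) = (c(h := s), h + head_offset m)"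

fun step :: "tm \<Rightarrow> config \<Rightarrow> config" where
  "step M (q, tps) =
     (if q < states M
      then (case delta M q (map read tps) of (q', acts) \<Rightarrow> (q', map2 act acts tps))
      else (q, tps))"

definition word_cells :: "nat list \<Rightarrow> int \<Rightarrow> nat" where
  "word_cells w i = (if 0 \<le> i \<and> i < int (length w) then w ! nat i else 0)"

text \<open>The input is on tape 0 and the output on tape 1.\<close>

definition start_config :: "tm \<Rightarrow> nat list \<Rightarrow> config" where
  "start_config M w = (0, (word_cells w, 0) # replicate (tapes M - 1) (word_cells [], 0))"

definition outputs_within :: "tm \<Rightarrow> nat list \<Rightarrow> nat list \<Rightarrow> nat \<Rightarrow> bool" where
  "outputs_within M w v T \<longleftrightarrow>
     (\<exists>n\<le>T. case (step M ^^ n) (start_config M w) of (q, tps) \<Rightarrow>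
        q = states M \<and> fst (tps ! 1) = word_cells v)"

text \<open>
  One machine and one polynomial serve all inputs \<open>x \<in> D\<close>; nothing is required of the machine
  on words that do not encode an element of \<open>D\<close>.
\<close>

definition poly_time_computable ::
    "'a set \<Rightarrow> ('a \<Rightarrow> nat list) \<Rightarrow> ('b \<Rightarrow> nat list) \<Rightarrow> ('a \<Rightarrow> 'b) \<Rightarrow> bool" where
  "poly_time_computable D enc_in enc_out f \<longleftrightarrow>
     (\<exists>M (p :: nat poly). wf_tm M \<and>
        (\<forall>x\<in>D. set (enc_in x) \<subseteq> {1..<symbols M} \<and>
           outputs_within M (enc_in x) (enc_out (f x)) (poly p (length (enc_in x)))))"


section \<open>Lists of integers given with their prime factorizations\<close>

text \<open>
  Binary digits, least significant first; the digits 0 and 1 are the tape symbols 1 and 2.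
\<close>

fun binary :: "nat \<Rightarrow> nat list" where
  "binary n = (if n = 0 then [] else (n mod 2 + 1) # binary (n div 2))"

declare binary.simps [simp del]

definition factorization_of :: "nat \<Rightarrow> (nat \<times> nat) list \<Rightarrow> bool" where
  "factorization_of a fs \<longleftrightarrow>
     distinct (map fst fs) \<and> (\<forall>(p, e)\<in>set fs. prime p \<and> 0 < e) \<and>
     a = (\<Prod>(p, e)\<leftarrow>fs. p ^ e)"

type_synonym factored_list = "(nat \<times> (nat \<times> nat) list) list"

definition factored_instances :: "factored_list set" where
  "factored_instances =
     {xs. admissible (map fst xs) \<and> (\<forall>(a, fs)\<in>set xs. factorization_of a fs)}"

text \<open>
  The symbols 3, 4, 5 are separators: an entry \<open>\<alpha> = p\<^sub>1 ^ e\<^sub>1 \<cdots> p\<^sub>k ^ e\<^sub>k\<close> is written as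
  \<open>\<alpha> 4 p\<^sub>1 3 e\<^sub>1 4 \<dots> p\<^sub>k 3 e\<^sub>k 4 5\<close>, all numbers in binary.
\<close>

definition encode_entry :: "nat \<times> (nat \<times> nat) list \<Rightarrow> nat list" where
  "encode_entry = (\<lambda>(a, fs).
     binary a @ [4] @ concat (map (\<lambda>(p, e). binary p @ [3] @ binary e @ [4]) fs) @ [5])"

definition encode_instance :: "factored_list \<Rightarrow> nat list" where
  "encode_instance xs = concat (map encode_entry xs)"

end

(*
  The generating function of the denumerant is the product of the 1 / (1 - x^a), so the denumerant
  is a sum of P_z(t) z^t over roots of unity z, where P_z has degree less than the number of entries
  a with z^a = 1, the pole order of z. The P_z are found by solving one difference equation per
  entry. For z ~= 1 the pole order is at most ell, because z^a = 1 for all a in J forces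
  z^(Gcd J) = 1; hence above degree ell - 1 only z = 1 contributes and the coefficients are constant.
  A primitive p-th root of unity, where p is a prime dividing ell of the entries, has pole order
  exactly ell, and its Fourier coefficient in E_(ell-1) does not vanish.

  For the algorithm, ell is the largest number of entries divisible by a common prime, i.e. the
  largest number of occurrences of one prime in the given factorizations.
*)
theory Submission
  imports Defs "HOL-Computational_Algebra.Computational_Algebra"
begin

section \<open>The recurrence of the denumerant\<close>

text \<open>Solving one difference equation per entry determines the expansion only up to a periodic
  function whose Fourier coefficients are unknown. If the pole at z first appears at a late entry,
  its leading coefficient is such an unknown number, and nothing shows that it is nonzero. Only for
  a one-element list is it explicit. The lower bound on E therefore needs a list whose last entry a
  satisfies z^a = 1. The denumerant does not depend on the order of the entries, so such an entry
  can be moved to the end; this symmetry is what the generating function is used for. The theorem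
  quantifies over every family E of periodic coefficients, so uniqueness of quasi-polynomial
  coefficients has to carry the result from the constructed expansion to an arbitrary E. On the
  algorithmic side no arithmetic on the input numbers takes place: with the primes written out,
  comparing digit strings replaces every divisibility test.\<close>

definition solutions :: "nat list \<Rightarrow> nat \<Rightarrow> nat list set" where
  "solutions as t = {xs. length xs = length as \<and> (\<Sum>i<length as. as ! i * xs ! i) = t}"

lemma denumerant_solutions: "denumerant as t = card (solutions as t)"
  by (simp add: denumerant_def solutions_def)

lemma solutions_Nil: "solutions [] t = (if t = 0 then {[]} else {})"
  by (auto simp: solutions_def)

lemma Cons_in_solutions: "x # xs \<in> solutions (a # as) t \<longleftrightarrow> a * x \<le> t \<and> xs \<in> solutions as (t - a * x)"
  by (auto simp: solutions_def sum.lessThan_Suc_shift simp del: sum.lessThan_Suc)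

lemma solutions_ConsD: "xs \<in> solutions (a # as) t \<Longrightarrow> \<exists>y ys. xs = y # ys \<and> a * y \<le> t \<and> ys \<in> solutions as (t - a * y)"
  by (cases xs) (simp_all add: Cons_in_solutions, simp add: solutions_def)

lemma finite_solutions:
  assumes "\<forall>a\<in>set as. 0 < a"
  shows "finite (solutions as t)"
proof (rule finite_subset)
  show "solutions as t \<subseteq> {xs. set xs \<subseteq> {..t} \<and> length xs = length as}"
  proof clarsimp
    fix xs assume xs: "xs \<in> solutions as t"
    then have len: "length xs = length as" by (simp add: solutions_def)
    have "x \<le> t" if "x \<in> set xs" for x
    proof -
      from that obtain i where i: "i < length as" "x = xs ! i"
        using len by (auto simp: in_set_conv_nth)
      have "x \<le> as ! i * xs ! i" using assms i by (simp add: Suc_leI)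
      also have "\<dots> \<le> (\<Sum>i<length as. as ! i * xs ! i)"
        using i by (intro member_le_sum) auto
      also have "\<dots> = t" using xs by (simp add: solutions_def)
      finally show ?thesis .
    qed
    with len show "set xs \<subseteq> {..t} \<and> length xs = length as" by auto
  qed
qed (rule finite_lists_length_eq, simp)

text \<open>A solution with first coordinate 0 is a solution for \<open>as\<close>; any other arises
  from one for \<open>t - a\<close> by raising the first coordinate by 1.\<close>

lemma denumerant_Cons:
  assumes "\<forall>b\<in>set (a # as). 0 < b"
  shows "denumerant (a # as) t = denumerant as t + (if a \<le> t then denumerant (a # as) (t - a) else 0)"
proof -
  let ?inc = "\<lambda>xs :: nat list. Suc (hd xs) # tl xs"
  have inj0: "inj_on ((#) (0::nat)) A" for A by (auto simp: inj_on_def)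
  have inj1: "inj_on ?inc (solutions (a # as) s)" for s
    by (auto simp: inj_on_def dest!: solutions_ConsD)
  let ?B = "if a \<le> t then ?inc ` solutions (a # as) (t - a) else {}"
  have "solutions (a # as) t = (#) 0 ` solutions as t \<union> ?B"
  proof (intro set_eqI iffI)
    fix xs assume xs: "xs \<in> solutions (a # as) t"
    then obtain y ys where y: "xs = y # ys" by (auto dest!: solutions_ConsD)
    show "xs \<in> (#) 0 ` solutions as t \<union> ?B"
    proof (cases y)
      case 0
      with xs y show ?thesis by (auto simp: Cons_in_solutions)
    next
      case (Suc z)
      with xs y have "z # ys \<in> solutions (a # as) (t - a)" "a \<le> t" by (auto simp: Cons_in_solutions)
      then have "?inc (z # ys) \<in> ?B" by (auto intro!: imageI simp del: list.sel)
      with Suc y show ?thesis by simp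
    qed
  next
    fix xs assume "xs \<in> (#) 0 ` solutions as t \<union> ?B"
    then show "xs \<in> solutions (a # as) t"
      by (auto simp: Cons_in_solutions dest!: solutions_ConsD split: if_splits)
  qed
  moreover have "(#) 0 ` solutions as t \<inter> ?B = {}" by auto
  moreover have "finite (solutions as t)" "finite (solutions (a # as) (t - a))"
    using assms by (simp_all add: finite_solutions)
  ultimately show ?thesis
    unfolding denumerant_solutions by (auto simp: card_Un_disjoint card_image inj0 inj1)
qed

lemma denumerant_Nil: "denumerant [] t = (if t = 0 then 1 else 0)"
  by (simp add: denumerant_solutions solutions_Nil)

text \<open>By the recurrence, multiplying the series of \<open>a # as\<close> by
  \<open>1 - fps_X ^ a\<close> leaves the series of \<open>as\<close>.\<close>

lemma prod_denumerant_fps: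
  assumes "\<forall>a\<in>set as. 0 < a"
  shows "(\<Prod>a\<leftarrow>as. 1 - fps_X ^ a) * Abs_fps (\<lambda>t. int (denumerant as t)) = 1"
  using assms
proof (induction as)
  case Nil
  show ?case by (simp add: fps_eq_iff denumerant_Nil)
next
  case (Cons a as)
  let ?D = "\<lambda>as. Abs_fps (\<lambda>t. int (denumerant as t))"
  have "(1 - fps_X ^ a) * ?D (a # as) = ?D as"
  proof (rule fps_ext)
    fix t
    show "((1 - fps_X ^ a) * ?D (a # as)) $ t = ?D as $ t"
      using denumerant_Cons[OF Cons.prems, of t]
      by (simp add: left_diff_distrib fps_X_power_mult_nth)
  qed
  then have "(\<Prod>a\<leftarrow>a # as. 1 - fps_X ^ a) * ?D (a # as) = (\<Prod>a\<leftarrow>as. 1 - fps_X ^ a) * ?D as"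
    by (simp add: mult.assoc mult.left_commute)
  then show ?case using Cons by simp
qed

text \<open>Both series are inverse to the same commutative product, which can be cancelled because
  power series over the integers form a domain.\<close>

lemma denumerant_mset_cong:
  assumes "mset as = mset bs" "\<forall>a\<in>set as. 0 < a"
  shows "denumerant as = denumerant bs"
proof -
  let ?D = "\<lambda>as. Abs_fps (\<lambda>t. int (denumerant as t))"
  have pos: "\<forall>a\<in>set bs. 0 < a" using assms by (metis mset_eq_setD)
  let ?P = "\<Prod>a\<leftarrow>as. 1 - fps_X ^ a :: int fps"
  have "?P = (\<Prod>a\<leftarrow>bs. 1 - fps_X ^ a)"
    using assms(1) by (metis mset_map prod_mset_prod_list)
  then have "?P * ?D as = ?P * ?D bs" and "?P \<noteq> 0"
    using prod_denumerant_fps[OF assms(2)] prod_denumerant_fps[OF pos] by auto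
  then have "?D as = ?D bs" by simp
  then show ?thesis by (auto simp: fps_eq_iff)
qed

section \<open>Uniqueness of the coefficient functions\<close>

lemma periodic_mult:
  assumes "\<And>t. f (t + q) = f (t::nat)"
  shows "f (t + q * k) = f t"
proof (induction k)
  case (Suc k)
  then show ?case using assms[of "t + q * k"] by (simp add: algebra_simps)
qed simp

lemma periodic_diff:
  assumes "periodic f" "periodic g"
  shows "periodic (\<lambda>t. f t - g t)"
proof -
  from assms obtain p q where p: "p > 0" "\<And>t. f (t + p) = f t" and q: "q > 0" "\<And>t. g (t + q) = g t"
    by (auto simp: periodic_def)
  have "f (t + p * q) = f t" "g (t + p * q) = g t" for t
    using periodic_mult[of f, OF p(2), of t q] periodic_mult[of g, OF q(2), of t p] by (simp_all add: mult.commute)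
  then show ?thesis unfolding periodic_def using p(1) q(1) by (intro exI[of _ "p * q"]) simp
qed

lemma common_period:
  assumes "\<forall>i\<le>N. periodic (F i)"
  shows "\<exists>q>0. \<forall>i\<le>(N::nat). \<forall>t. F i (t + q) = F i t"
proof -
  from assms obtain q where q: "\<And>i. i \<le> N \<Longrightarrow> q i > 0" "\<And>i t. i \<le> N \<Longrightarrow> F i (t + q i) = F i t"
    unfolding periodic_def by metis
  have "F i (t + (\<Prod>i\<le>N. q i)) = F i t" if "i \<le> N" for i t
  proof -
    have "q i dvd (\<Prod>i\<le>N. q i)" using that by (intro dvd_prodI) auto
    then show ?thesis using periodic_mult[of "F i", OF q(2)[OF that]] by (auto elim: dvdE)
  qed
  moreover have "(\<Prod>i\<le>N. q i) > 0" using q(1) by (intro prod_pos) auto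
  ultimately show ?thesis by blast
qed

text \<open>With a common period q, all \<open>F i\<close> are constant along t, t + q, t + 2q, ...,
  where the quasi-polynomial is thus an ordinary polynomial with infinitely many zeros.\<close>

lemma quasi_polynomial_eq_0:
  fixes F :: "nat \<Rightarrow> nat \<Rightarrow> 'a::field_char_0"
  assumes "\<forall>i\<le>N. periodic (F i)" "\<And>t. (\<Sum>i\<le>N. F i t * of_nat t ^ i) = 0" "i \<le> N"
  shows "F i t = 0"
proof -
  from common_period[OF assms(1)] obtain q where q: "q > 0" "\<And>i t. i \<le> N \<Longrightarrow> F i (t + q) = F i t" by blast
  define P where "P = (\<Sum>i\<le>N. monom (F i t) i)"
  have "poly P (of_nat (t + q * k)) = 0" for k
  proof -
    have "poly P (of_nat (t + q * k)) = (\<Sum>i\<le>N. F i (t + q * k) * of_nat (t + q * k) ^ i)"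
      unfolding P_def poly_sum poly_monom
      by (intro sum.cong refl) (use periodic_mult[of "F _", OF q(2)] in simp)
    then show ?thesis using assms(2) by (simp only:)
  qed
  then have "range (\<lambda>k. of_nat (t + q * k)) \<subseteq> {x. poly P x = 0}" by blast
  moreover have "infinite (range (\<lambda>k. of_nat (t + q * k) :: 'a))"
    using q(1) by (intro range_inj_infinite) (auto simp: inj_on_def simp del: of_nat_add of_nat_mult)
  ultimately have "P = 0" using poly_roots_finite finite_subset by blast
  moreover have "coeff P i = F i t"
    using assms(3) by (simp add: P_def coeff_sum)
  ultimately show ?thesis by simp
qed

lemma quasi_polynomial_unique:
  fixes F G :: "nat \<Rightarrow> nat \<Rightarrow> 'a::field_char_0"
  assumes "\<forall>i\<le>N. periodic (F i)" "\<forall>i\<le>N. periodic (G i)"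
    "\<And>t. (\<Sum>i\<le>N. F i t * of_nat t ^ i) = (\<Sum>i\<le>N. G i t * of_nat t ^ i)" "i \<le> N"
  shows "F i t = G i t"
proof -
  have "F i t - G i t = 0"
    using assms by (intro quasi_polynomial_eq_0[where N = N and F = "\<lambda>i t. F i t - G i t"])
      (auto intro: periodic_diff simp: left_diff_distrib sum_subtractf)
  then show ?thesis by simp
qed

section \<open>Difference equations for polynomials\<close>

lemma linear_power_coeffs:
  fixes a :: "'a::idom"
  shows "coeff ([:-a, 1:] ^ n) n = 1"
    and "k > n \<Longrightarrow> coeff ([:-a, 1:] ^ n) k = 0"
    and "n > 0 \<Longrightarrow> coeff ([:-a, 1:] ^ n) (n - 1) = - of_nat n * a"
proof -
  show "coeff ([:-a, 1:] ^ n) n = 1" by (rule coeff_linear_power)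
  show "k > n \<Longrightarrow> coeff ([:-a, 1:] ^ n) k = 0"
    by (rule coeff_eq_0) (simp add: degree_linear_power)
  show "n > 0 \<Longrightarrow> coeff ([:-a, 1:] ^ n) (n - 1) = - of_nat n * a"
    by (cases n) (simp_all add: coeff_linear_poly_power del: power_Suc of_nat_Suc)
qed

text \<open>The operator p(X) - c p(X - a). A sequence Q(t) z^t differs from its shift by a by (Q(t)
  - z^(-a) Q(t - a)) z^t, so the recurrence turns into this operator with c = z^(-a).\<close>

definition twisted_diff :: "'a::field_char_0 \<Rightarrow> 'a \<Rightarrow> 'a poly \<Rightarrow> 'a poly" where
  "twisted_diff c a p = p - smult c (pcompose p [:-a, 1:])"

lemma twisted_diff_add: "twisted_diff c a (p + q) = twisted_diff c a p + twisted_diff c a q"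
  by (simp add: twisted_diff_def pcompose_add smult_add_right)

lemma pcompose_monom: "pcompose (monom b n) q = smult b (q ^ n)"
  by (induction n) (simp_all add: monom_Suc pcompose_pCons pcompose_const monom_0 mult_smult_right)

lemma twisted_diff_monom: "twisted_diff c a (monom b n) = monom b n - smult (c * b) ([:-a, 1:] ^ n)"
  by (simp add: twisted_diff_def pcompose_monom)

text \<open>For c other than 1 the operator keeps the degree and multiplies the leading coefficient
  by 1 - c, so a monomial removes the top term and induction does the rest. The bound n exceeds the
  degree by one, which makes n = 0 the zero polynomial.\<close>

lemma twisted_diff_solve:
  assumes "c \<noteq> 1" "\<forall>k\<ge>n. coeff p k = 0"
  shows "\<exists>q. twisted_diff c a q = p \<and> (\<forall>k\<ge>n. coeff q k = 0) \<and>
    (n > 0 \<longrightarrow> coeff q (n - 1) = coeff p (n - 1) / (1 - c))"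
  using assms(2)
proof (induction n arbitrary: p)
  case 0
  then have "p = 0" by (simp add: poly_eq_iff)
  then show ?case by (intro exI[of _ 0]) (simp add: twisted_diff_def)
next
  case (Suc n)
  define b where "b = coeff p n / (1 - c)"
  have "\<forall>k\<ge>n. coeff (p - twisted_diff c a (monom b n)) k = 0"
  proof (intro allI impI)
    fix k assume "k \<ge> n"
    then consider "k = n" | "k > n" by linarith
    then show "coeff (p - twisted_diff c a (monom b n)) k = 0"
    proof cases
      case 1
      have "b - c * b = b * (1 - c)" by (simp add: algebra_simps)
      also have "\<dots> = coeff p n" using assms(1) by (simp add: b_def)
      finally have "b - c * b = coeff p n" .
      then show ?thesis using 1 by (simp add: twisted_diff_monom linear_power_coeffs)
    next
      case 2
      then show ?thesis using Suc.prems by (simp add: twisted_diff_monom linear_power_coeffs)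
    qed
  qed
  from Suc.IH[OF this] obtain q where q: "twisted_diff c a q = p - twisted_diff c a (monom b n)"
    "\<forall>k\<ge>n. coeff q k = 0" by (elim exE conjE)
  have "twisted_diff c a (q + monom b n) = p" using q(1) by (simp add: twisted_diff_add)
  moreover have "coeff (q + monom b n) n = coeff p n / (1 - c)" using q(2) by (simp add: b_def)
  moreover have "\<forall>k\<ge>Suc n. coeff (q + monom b n) k = 0" using q(2) by simp
  ultimately show ?case by (intro exI[of _ "q + monom b n"]) simp
qed

text \<open>For c = 1 the leading terms cancel: X^n becomes n a X^(n - 1) plus lower terms. The
  solution therefore gains one degree, which is how an entry with z^a = 1 raises the pole
  order.\<close>

lemma diff_solve:
  assumes "a \<noteq> 0" "\<forall>k\<ge>n. coeff p k = 0"
  shows "\<exists>q. twisted_diff 1 a q = p \<and> (\<forall>k>n. coeff q k = 0) \<and>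
    (n > 0 \<longrightarrow> coeff q n = coeff p (n - 1) / (of_nat n * a))"
  using assms(2)
proof (induction n arbitrary: p)
  case 0
  then have "p = 0" by (simp add: poly_eq_iff)
  then show ?case by (intro exI[of _ 0]) (simp add: twisted_diff_def)
next
  case (Suc n)
  define b where "b = coeff p n / (of_nat (Suc n) * a)"
  have "\<forall>k\<ge>n. coeff (p - twisted_diff 1 a (monom b (Suc n))) k = 0"
  proof (intro allI impI)
    fix k assume "k \<ge> n"
    then consider "k = n" | "k = Suc n" | "k > Suc n" by linarith
    then show "coeff (p - twisted_diff 1 a (monom b (Suc n))) k = 0"
    proof cases
      case 1
      have "b * (of_nat (Suc n) * a) = coeff p n" using assms(1) by (simp add: b_def del: of_nat_Suc)
      moreover have "coeff ([:-a, 1:] ^ Suc n) n = - (of_nat (Suc n) * a)"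
        using linear_power_coeffs(3)[of "Suc n" a] by (simp del: power_Suc of_nat_Suc)
      ultimately show ?thesis using 1
        by (simp add: twisted_diff_monom del: power_Suc of_nat_Suc)
    next
      case 2
      then show ?thesis using Suc.prems linear_power_coeffs(1)[of a "Suc n"] by (simp add: twisted_diff_monom del: power_Suc)
    next
      case 3
      then show ?thesis using Suc.prems linear_power_coeffs(2)[of "Suc n" k a] by (simp add: twisted_diff_monom del: power_Suc)
    qed
  qed
  from Suc.IH[OF this] obtain q where q: "twisted_diff 1 a q = p - twisted_diff 1 a (monom b (Suc n))"
    "\<forall>k>n. coeff q k = 0" by (elim exE conjE)
  have "twisted_diff 1 a (q + monom b (Suc n)) = p" using q(1) by (simp add: twisted_diff_add)
  moreover have "coeff (q + monom b (Suc n)) (Suc n) = coeff p n / (of_nat (Suc n) * a)"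
    using q(2) by (simp add: b_def)
  moreover have "\<forall>k>Suc n. coeff (q + monom b (Suc n)) k = 0" using q(2) by simp
  ultimately show ?case by (intro exI[of _ "q + monom b (Suc n)"]) simp
qed

section \<open>Roots of unity\<close>

text \<open>With w = exp(2 pi i n / a) the sum is a geometric series of a terms. Its numerator w^a -
  1 vanishes, and w is 1 only if a divides n.\<close>

lemma sum_powers_roots_unity:
  assumes "a > 0"
  shows "(\<Sum>z | z ^ a = (1::complex). z ^ n) = (if a dvd n then of_nat a else 0)"
proof (cases "a dvd n")
  case True
  then obtain k where "n = a * k" by (auto elim: dvdE)
  then have "(\<Sum>z | z ^ a = (1::complex). z ^ n) = (\<Sum>z | z ^ a = (1::complex). 1)"
    by (intro sum.cong) (auto simp: power_mult)
  then show ?thesis using True assms by (simp add: card_roots_unity_eq)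
next
  case False
  define w where "w = cis (2 * pi * real n / real a)"
  have w: "w \<noteq> 1"
  proof
    assume "w = 1"
    then have "cos (2 * pi * real n / real a) = 1" by (simp add: w_def complex_eq_iff)
    then obtain x :: int where "2 * pi * real n / real a = of_int x * 2 * pi"
      using cos_one_2pi_int by blast
    then have "real n = of_int x * real a" using assms by (simp add: field_simps)
    then have "int n = x * int a" by (metis of_int_eq_iff of_int_mult of_int_of_nat_eq)
    then have "int a dvd int n" by simp
    with False show False by (simp add: int_dvd_int_iff)
  qed
  have "(\<Sum>z | z ^ a = (1::complex). z ^ n) = (\<Sum>k<a. cis (2 * pi * real k / real a) ^ n)"
    using sum.reindex_bij_betw[OF bij_betw_roots_unity[OF assms], of "\<lambda>z. z ^ n"] by simp
  also have "\<dots> = (\<Sum>k<a. w ^ k)"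
    by (intro sum.cong refl) (simp add: w_def DeMoivre algebra_simps)
  also have "\<dots> = (w ^ a - 1) / (w - 1)"
    using w by (simp add: geometric_sum)
  also have "w ^ a = 1"
    using assms by (simp add: w_def DeMoivre)
  finally show ?thesis using False by simp
qed

lemma periodic_Fourier:
  fixes h :: "nat \<Rightarrow> complex"
  assumes "a > 0" "\<And>t. h (t + a) = h t"
  shows "\<exists>c. \<forall>t. h t = (\<Sum>z | z ^ a = 1. c z * z ^ t)"
proof (intro exI allI)
  fix t
  let ?U = "{z::complex. z ^ a = 1}"
  \<comment> \<open>The discrete Fourier coefficient of h; \<open>z ^ (a - s)\<close> stands for
    z^(-s), because z^a = 1.\<close>
  let ?c = "\<lambda>z. (\<Sum>s<a. h s * z ^ (a - s)) / of_nat a"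
  have "(\<Sum>z\<in>?U. ?c z * z ^ t) = (\<Sum>z\<in>?U. \<Sum>s<a. h s / of_nat a * z ^ (t + (a - s)))"
  proof (intro sum.cong refl)
    fix z
    have "?c z * z ^ t = (\<Sum>s<a. h s / of_nat a * (z ^ t * z ^ (a - s)))"
      by (simp add: sum_divide_distrib sum_distrib_left mult_ac)
    then show "?c z * z ^ t = (\<Sum>s<a. h s / of_nat a * z ^ (t + (a - s)))"
      by (simp only: power_add)
  qed
  also have "\<dots> = (\<Sum>s<a. h s / of_nat a * (\<Sum>z\<in>?U. z ^ (t + (a - s))))"
    by (subst sum.swap) (simp add: sum_distrib_left)
  also have "\<dots> = (\<Sum>s<a. if s = t mod a then h s else 0)"
  proof (intro sum.cong refl)
    fix s assume "s \<in> {..<a}"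
    then have s: "s < a" by simp
    have "a dvd t + (a - s) \<longleftrightarrow> s = t mod a"
    proof -
      have "int (t + (a - s)) = int t - int s + int a" using s by simp
      then have "a dvd t + (a - s) \<longleftrightarrow> int a dvd int t - int s + int a"
        by (metis int_dvd_int_iff)
      also have "\<dots> \<longleftrightarrow> int a dvd int t - int s" by simp
      also have "\<dots> \<longleftrightarrow> int t mod int a = int s mod int a" by (simp add: mod_eq_dvd_iff)
      also have "\<dots> \<longleftrightarrow> s = t mod a" using s by (metis mod_less of_nat_eq_iff zmod_int)
      finally show ?thesis .
    qed
    then show "h s / of_nat a * (\<Sum>z\<in>?U. z ^ (t + (a - s))) = (if s = t mod a then h s else 0)"
      using assms(1) by (simp add: sum_powers_roots_unity)
  qed
  also have "\<dots> = h (t mod a)" using assms(1) by simp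
  also have "\<dots> = h t"
    using periodic_mult[of h a, OF assms(2), of "t mod a" "t div a"] by (simp add: add.commute)
  finally show "h t = (\<Sum>z\<in>?U. ?c z * z ^ t)" by simp
qed

section \<open>The expansion over roots of unity\<close>

text \<open>The order of the pole at \<open>1 / z\<close> of the generating function \<open>\<Prod> 1 / (1 - x\<^sup>a)\<close>.\<close>

definition pole_order :: "complex \<Rightarrow> nat list \<Rightarrow> nat" where
  "pole_order z as = length (filter (\<lambda>a. z ^ a = 1) as)"

lemma denumerant_single:
  assumes "0 < a"
  shows "denumerant [a] t = (if a dvd t then 1 else 0)"
proof (induction t rule: less_induct)
  case (less t)
  have rec: "denumerant [a] t = (if t = 0 then 1 else 0) + (if a \<le> t then denumerant [a] (t - a) else 0)"
    using denumerant_Cons[of a "[]" t] assms by (simp add: denumerant_Nil)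
  show ?case
  proof (cases "a \<le> t")
    case True
    then have "denumerant [a] (t - a) = (if a dvd t - a then 1 else 0)" using less assms by simp
    with rec True assms show ?thesis by (simp add: dvd_minus_self)
  next
    case False
    with rec show ?thesis by (auto dest: dvd_imp_le)
  qed
qed

text \<open>The factor z^(-a) is 1 exactly when the entry a adds to the pole order, which selects
  one of the two difference equations. Once the order is positive, the leading coefficient is merely
  divided by a nonzero number.\<close>

lemma recurrence_coefficient:
  fixes z :: complex
  assumes "0 < a" "\<forall>k\<ge>pole_order z as. coeff p k = 0"
  shows "\<exists>q. twisted_diff (inverse z ^ a) (of_nat a) q = p \<and>
    (\<forall>k\<ge>pole_order z (a # as). coeff q k = 0) \<and>
    (0 < pole_order z as \<longrightarrow> coeff p (pole_order z as - 1) \<noteq> 0 \<longrightarrow>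
       coeff q (pole_order z (a # as) - 1) \<noteq> 0)"
proof (cases "z ^ a = 1")
  case True
  have "(of_nat a :: complex) \<noteq> 0" using assms(1) by simp
  from diff_solve[OF this assms(2)] obtain q where q: "twisted_diff 1 (of_nat a) q = p"
    "\<forall>k>pole_order z as. coeff q k = 0"
    "0 < pole_order z as \<longrightarrow> coeff q (pole_order z as) = coeff p (pole_order z as - 1) / (of_nat (pole_order z as) * of_nat a)"
    by (elim exE conjE)
  moreover have "inverse z ^ a = 1" using True by (simp add: power_inverse)
  ultimately show ?thesis using True assms(1) by (intro exI[of _ q]) (simp add: pole_order_def Suc_le_eq)
next
  case False
  then have c: "inverse z ^ a \<noteq> 1" by (simp add: power_inverse)
  from twisted_diff_solve[OF c assms(2), of "of_nat a"] obtain q where q: "twisted_diff (inverse z ^ a) (of_nat a) q = p"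
    "\<forall>k\<ge>pole_order z as. coeff q k = 0"
    "0 < pole_order z as \<longrightarrow> coeff q (pole_order z as - 1) = coeff p (pole_order z as - 1) / (1 - inverse z ^ a)"
    by (elim exE conjE)
  with c False show ?thesis by (intro exI[of _ q]) (simp add: pole_order_def)
qed

text \<open>In use, x = Q(t + a), y = Q(t), p = P(t + a), i = z^(-a), u = z^a and v = z^t.\<close>

lemma shift_identity:
  fixes i p x y u v :: "'a::comm_ring_1"
  assumes "p = x - i * y" "i * u = 1"
  shows "x * (v * u) = y * v + p * (v * u)"
proof -
  have "p * (v * u) = x * (v * u) - y * v * (i * u)"
    by (simp add: assms(1) algebra_simps)
  then show ?thesis by (simp add: assms(2))
qed

lemma finite_roots: "0 < L \<Longrightarrow> finite {z::complex. z ^ L = 1}"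
  by (intro finite_roots_unity) simp

lemma pole_order_last_pos:
  assumes "as \<noteq> []" "z ^ last as = 1"
  shows "0 < pole_order z as"
  using assms last_in_set[of as] by (auto simp: pole_order_def filter_empty_conv)

text \<open>
  Passing from \<open>as\<close> to \<open>a # as\<close> leaves an undetermined \<open>a\<close>-periodic summand, which only affects the
  constant coefficients. If the last entry already contributes to the pole at \<open>z\<close>, these
  are below the top degree, so the leading coefficient is controlled from the start.
\<close>

lemma denumerant_expansion:
  assumes "as \<noteq> []" "\<forall>a\<in>set as. 0 < a" "0 < L" "\<forall>a\<in>set as. a dvd L"
  shows "\<exists>P :: complex \<Rightarrow> complex poly.
    (\<forall>t. of_nat (denumerant as t) = (\<Sum>z | z ^ L = 1. poly (P z) (of_nat t) * z ^ t)) \<and>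
    (\<forall>z k. pole_order z as \<le> k \<longrightarrow> coeff (P z) k = 0) \<and>
    (\<forall>z. z ^ last as = 1 \<longrightarrow> coeff (P z) (pole_order z as - 1) \<noteq> 0)"
  using assms(1,2,4)
proof (induction as rule: list_nonempty_induct)
  case (single a)
  \<comment> \<open>The indicator of the multiples of a is the average of z^t over the a-th roots of
    unity z.\<close>
  let ?P = "\<lambda>z :: complex. if z ^ a = 1 then [:1 / of_nat a:] else 0"
  have a: "0 < a" "a dvd L" using single by auto
  have sub: "{z::complex. z ^ a = 1} \<subseteq> {z. z ^ L = 1}" using a(2) by (auto elim!: dvdE simp: power_mult)
  have "of_nat (denumerant [a] t) = (\<Sum>z | z ^ L = 1. poly (?P z) (of_nat t) * z ^ t)" for t
  proof -
    have "(\<Sum>z | z ^ L = 1. poly (?P z) (of_nat t) * z ^ t) = (\<Sum>z | z ^ a = 1. 1 / of_nat a * z ^ t)"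
      using finite_roots[OF assms(3)] sub by (intro sum.mono_neutral_cong_right) auto
    also have "\<dots> = of_nat (denumerant [a] t)"
      using sum_powers_roots_unity[OF a(1), of t] a(1)
      by (simp add: denumerant_single flip: sum_divide_distrib)
    finally show ?thesis by simp
  qed
  then show ?case
    using a(1) by (intro exI[of _ ?P]) (auto simp: pole_order_def coeff_pCons split: nat.split)
next
  case (cons a as)
  have pos: "0 < a" "\<forall>a\<in>set as. 0 < a" and dvd: "a dvd L" "\<forall>a\<in>set as. a dvd L"
    using cons.prems by auto
  from cons.IH[OF pos(2) dvd(2)] obtain P :: "complex \<Rightarrow> complex poly" where
    P: "\<And>t. of_nat (denumerant as t) = (\<Sum>z | z ^ L = 1. poly (P z) (of_nat t) * z ^ t)"
    and P0: "\<And>z. \<forall>k\<ge>pole_order z as. coeff (P z) k = 0"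
    and Pl: "\<And>z. z ^ last as = 1 \<Longrightarrow> coeff (P z) (pole_order z as - 1) \<noteq> 0" by blast
  from recurrence_coefficient[OF pos(1) P0] obtain Q where
    Q: "\<And>z. twisted_diff (inverse z ^ a) (of_nat a) (Q z) = P z"
    and Q0: "\<And>z k. k \<ge> pole_order z (a # as) \<Longrightarrow> coeff (Q z) k = 0"
    and Ql: "\<And>z. 0 < pole_order z as \<Longrightarrow> coeff (P z) (pole_order z as - 1) \<noteq> 0 \<Longrightarrow>
       coeff (Q z) (pole_order z (a # as) - 1) \<noteq> 0"
    by metis
  let ?f = "\<lambda>t. \<Sum>z | z ^ L = 1. poly (Q z) (of_nat t) * z ^ t"
  \<comment> \<open>Both terms of h satisfy the same recurrence, so h is a-periodic and hence a
    combination of powers of a-th roots of unity.\<close>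
  define h where "h t = of_nat (denumerant (a # as) t) - ?f t" for t
  have "h (t + a) = h t" for t
  proof -
    have "?f (t + a) = ?f t + (\<Sum>z | z ^ L = 1. poly (P z) (of_nat (t + a)) * z ^ (t + a))"
      unfolding sum.distrib[symmetric]
    proof (intro sum.cong refl)
      fix z :: complex assume "z \<in> {z. z ^ L = 1}"
      then have "z \<noteq> 0" using assms(3) by (auto simp: zero_power)
      have "poly (P z) (of_nat (t + a)) = poly (Q z) (of_nat (t + a)) - inverse z ^ a * poly (Q z) (of_nat t)"
        by (subst Q[symmetric]) (simp add: twisted_diff_def poly_pcompose)
      moreover have "inverse z ^ a * z ^ a = 1"
        using \<open>z \<noteq> 0\<close> by (simp flip: power_mult_distrib)
      ultimately show "poly (Q z) (of_nat (t + a)) * z ^ (t + a) =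
          poly (Q z) (of_nat t) * z ^ t + poly (P z) (of_nat (t + a)) * z ^ (t + a)"
        unfolding power_add by (rule shift_identity)
    qed
    also have "\<dots> = ?f t + of_nat (denumerant as (t + a))" by (simp only: P)
    finally show ?thesis
      using denumerant_Cons[OF cons.prems(1), of "t + a"] by (simp add: h_def)
  qed
  from periodic_Fourier[of a h, OF pos(1) this] obtain c where c: "\<And>t. h t = (\<Sum>z | z ^ a = 1. c z * z ^ t)"
    by blast
  define R where "R z = Q z + (if z ^ a = 1 then [:c z:] else 0)" for z
  have sub: "{z::complex. z ^ a = 1} \<subseteq> {z. z ^ L = 1}" using dvd(1) by (auto elim!: dvdE simp: power_mult)
  have "of_nat (denumerant (a # as) t) = (\<Sum>z | z ^ L = 1. poly (R z) (of_nat t) * z ^ t)" for t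
  proof -
    have "(\<Sum>z | z ^ L = 1. (if z ^ a = 1 then c z else 0) * z ^ t) = h t"
      unfolding c using finite_roots[OF assms(3)] sub by (intro sum.mono_neutral_cong_right) auto
    moreover have "(\<Sum>z | z ^ L = 1. poly (R z) (of_nat t) * z ^ t) =
        ?f t + (\<Sum>z | z ^ L = 1. (if z ^ a = 1 then c z else 0) * z ^ t)"
      unfolding sum.distrib[symmetric] by (intro sum.cong refl) (simp add: R_def distrib_right)
    ultimately show ?thesis by (simp add: h_def)
  qed
  moreover have "coeff (R z) k = 0" if "pole_order z (a # as) \<le> k" for z k
  proof -
    \<comment> \<open>If z^a = 1, the order is at least 1, so the added constant respects the degree
      bound.\<close>
    have "k \<noteq> 0" if "z ^ a = 1" using that \<open>pole_order z (a # as) \<le> k\<close> by (auto simp: pole_order_def)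
    then show ?thesis using Q0[OF that] by (auto simp: R_def coeff_pCons split: nat.split)
  qed
  moreover have "coeff (R z) (pole_order z (a # as) - 1) \<noteq> 0" if "z ^ last (a # as) = 1" for z
  proof -
    have z: "z ^ last as = 1" using that cons.hyps by simp
    have o: "0 < pole_order z as" by (rule pole_order_last_pos[OF cons.hyps z])
    \<comment> \<open>If z^a = 1, the order is now at least 2, so the unknown constant
      \<open>c z\<close> does not reach the leading coefficient.\<close>
    then have "pole_order z (a # as) - 1 \<noteq> 0" if "z ^ a = 1" using that by (simp add: pole_order_def)
    then have "coeff (R z) (pole_order z (a # as) - 1) = coeff (Q z) (pole_order z (a # as) - 1)"
      by (auto simp: R_def coeff_pCons split: nat.split)
    then show ?thesis using Ql[OF o Pl[OF z]] by simp
  qed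
  ultimately show ?case by blast
qed

section \<open>The number \<open>ell\<close> and the pole orders\<close>

lemma ell_set:
  defines "S \<equiv> \<lambda>as. {card J |J. J \<subseteq> {..<length as} \<and> J \<noteq> {} \<and> Gcd ((\<lambda>j. as ! j) ` J) \<noteq> (1::nat)}"
  assumes "admissible as"
  shows "finite (S as)" "S as \<noteq> {}"
proof -
  have "S as \<subseteq> card ` Pow {..<length as}" by (auto simp: S_def)
  then show "finite (S as)" by (rule finite_subset) simp
  from assms obtain bs where bs: "subseq bs as" "bs \<noteq> []" "Gcd (set bs) \<noteq> 1"
    by (auto simp: admissible_def)
  \<comment> \<open>All positions that carry a value of \<open>bs\<close>, not only those of the
    sublist: just the set of values enters the gcd.\<close>
  define J where "J = {j. j < length as \<and> as ! j \<in> set bs}"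
  have "set bs \<subseteq> set as" using bs(1) by (metis subseq_order.dual_order.refl notin_set_nthsI subseq_conv_nths subsetI)
  then have "(\<lambda>j. as ! j) ` J = set bs" by (force simp: J_def in_set_conv_nth)
  then have "card J \<in> S as" using bs by (auto simp: S_def J_def)
  then show "S as \<noteq> {}" by blast
qed

lemma card_le_ell:
  assumes "admissible as" "J \<subseteq> {..<length as}" "J \<noteq> {}" "Gcd ((\<lambda>j. as ! j) ` J) \<noteq> 1"
  shows "card J \<le> ell as"
  unfolding ell_def by (rule Max_ge) (use ell_set[OF assms(1)] assms in auto)

lemma ell_attained:
  assumes "admissible as"
  obtains J where "J \<subseteq> {..<length as}" "J \<noteq> {}" "Gcd ((\<lambda>j. as ! j) ` J) \<noteq> 1" "card J = ell as"
proof -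
  from Max_in[OF ell_set[OF assms]] obtain J where "J \<subseteq> {..<length as}" "J \<noteq> {}"
    "Gcd ((\<lambda>j. as ! j) ` J) \<noteq> 1" "ell as = card J"
    unfolding ell_def by blast
  with that[of J] show thesis by simp
qed

lemma card_indices_le_ell:
  assumes "admissible as" "(p::nat) \<noteq> 1"
  shows "card {i. i < length as \<and> p dvd as ! i} \<le> ell as"
proof (cases "{i. i < length as \<and> p dvd as ! i} = {}")
  case False
  have "p dvd Gcd ((\<lambda>j. as ! j) ` {i. i < length as \<and> p dvd as ! i})"
    by (auto intro: Gcd_greatest)
  then show ?thesis using assms False by (intro card_le_ell) auto
qed (auto simp only: card.empty)

text \<open>A prime factor of the gcd of a maximal J divides every entry indexed by J and, by
  maximality, no other entry.\<close>

lemma ell_eq_card_prime: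
  assumes "admissible as"
  obtains p where "prime p" "0 < ell as" "card {i. i < length as \<and> p dvd as ! i} = ell as"
proof -
  from ell_attained[OF assms] obtain J where J: "J \<subseteq> {..<length as}" "J \<noteq> {}"
    "Gcd ((\<lambda>j. as ! j) ` J) \<noteq> 1" "card J = ell as" .
  obtain p where p: "prime p" "p dvd Gcd ((\<lambda>j. as ! j) ` J)"
    using J(3) prime_factor_nat by blast
  have "finite J" using J(1) finite_subset by blast
  then have "0 < ell as" using J(2,4) by (simp add: card_gt_0_iff flip: J(4))
  moreover have "J \<subseteq> {i. i < length as \<and> p dvd as ! i}"
    using J(1) p(2) by (auto intro: dvd_trans Gcd_dvd)
  then have "ell as \<le> card {i. i < length as \<and> p dvd as ! i}"
    unfolding J(4)[symmetric] by (intro card_mono) auto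
  with card_indices_le_ell[OF assms, of p] p(1) have "card {i. i < length as \<and> p dvd as ! i} = ell as"
    by fastforce
  ultimately show thesis using p(1) that by blast
qed

lemma power_gcd_eq_1:
  fixes z :: complex
  assumes "z ^ a = 1" "z ^ b = 1"
  shows "z ^ gcd a b = 1"
proof (cases "a = 0")
  case False
  then obtain x y where "a * x = b * y + gcd a b" using bezout_nat by blast
  then have "z ^ (a * x) = z ^ (b * y) * z ^ gcd a b" by (simp add: power_add)
  then show ?thesis by (simp add: assms power_mult)
qed (use assms in simp)

lemma power_Gcd_eq_1:
  fixes z :: complex
  assumes "finite A" "\<forall>a\<in>A. z ^ a = 1"
  shows "z ^ Gcd A = 1"
  using assms by (induction A rule: finite_induct) (auto intro: power_gcd_eq_1)

lemma pole_order_le_ell: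
  assumes "admissible as" "z \<noteq> 1"
  shows "pole_order z as \<le> ell as"
proof -
  let ?J = "{i. i < length as \<and> z ^ (as ! i) = 1}"
  have card: "pole_order z as = card ?J" by (simp add: pole_order_def length_filter_conv_card)
  show ?thesis
  proof (cases "?J = {}")
    case True
    then show ?thesis using card by (simp only: card.empty)
  next
    case False
    have "z ^ Gcd ((\<lambda>j. as ! j) ` ?J) = 1" by (rule power_Gcd_eq_1) auto
    then have "Gcd ((\<lambda>j. as ! j) ` ?J) \<noteq> 1" using assms(2) by auto
    then show ?thesis unfolding card using False by (intro card_le_ell[OF assms(1)]) auto
  qed
qed

lemma pole_order_ell:
  assumes "admissible as"
  obtains z where "z \<noteq> 1" "pole_order z as = ell as" "0 < ell as"
proof -
  obtain p where p: "prime p" "0 < ell as" "card {i. i < length as \<and> p dvd as ! i} = ell as"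
    using ell_eq_card_prime[OF assms] .
  define z where "z = cis (2 * pi / real p)"
  have p1: "1 < p" using p(1) prime_gt_1_nat by blast
  have "z \<noteq> 1"
  proof
    assume "z = 1"
    then have "cos (2 * pi / real p) = 1" by (simp add: z_def complex_eq_iff)
    then obtain x :: int where "2 * pi / real p = of_int x * 2 * pi" using cos_one_2pi_int by blast
    then have "1 = of_int x * real p" using p1 by (simp add: field_simps)
    then have "1 = x * int p" by (metis of_int_1 of_int_eq_iff of_int_mult of_int_of_nat_eq)
    then have "int p dvd 1" by (metis dvd_triv_right)
    then show False using p1 by simp
  qed
  have "z ^ p = 1" using p1 by (simp add: z_def DeMoivre)
  then have "z ^ a = 1" if "p dvd a" for a using that by (auto elim!: dvdE simp: power_mult)
  then have "ell as \<le> pole_order z as"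
    unfolding p(3)[symmetric] pole_order_def length_filter_conv_card by (intro card_mono) auto
  with pole_order_le_ell[OF assms \<open>z \<noteq> 1\<close>] \<open>z \<noteq> 1\<close> p(2) that show thesis by force
qed

section \<open>Fourier coefficients of the coefficient functions\<close>

text \<open>The powers of z / w form a geometric series that vanishes over L terms unless z = w.
  This isolates the Fourier coefficient at w.\<close>

lemma sum_orthogonality:
  fixes w :: complex
  assumes "0 < L" "w ^ L = 1"
  shows "(\<Sum>t<L. (\<Sum>z | z ^ L = 1. c z * z ^ t) * inverse w ^ t) = of_nat L * c w"
proof -
  let ?U = "{z::complex. z ^ L = 1}"
  have "(\<Sum>t<L. (\<Sum>z\<in>?U. c z * z ^ t) * inverse w ^ t) = (\<Sum>z\<in>?U. c z * (\<Sum>t<L. (z * inverse w) ^ t))"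
    unfolding sum_distrib_left sum_distrib_right
    by (subst sum.swap) (simp add: power_mult_distrib mult_ac)
  also have "\<dots> = (\<Sum>z\<in>?U. if z = w then of_nat L * c w else 0)"
  proof (intro sum.cong refl)
    fix z assume "z \<in> ?U"
    have "w \<noteq> 0" using assms by (auto simp: zero_power)
    show "c z * (\<Sum>t<L. (z * inverse w) ^ t) = (if z = w then of_nat L * c w else 0)"
    proof (cases "z = w")
      case True
      then show ?thesis using \<open>w \<noteq> 0\<close> by simp
    next
      case False
      then have "z * inverse w \<noteq> 1" using \<open>w \<noteq> 0\<close> by (simp add: field_simps)
      then have "(\<Sum>t<L. (z * inverse w) ^ t) = ((z * inverse w) ^ L - 1) / (z * inverse w - 1)"
        by (rule geometric_sum)
      also have "(z * inverse w) ^ L = 1"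
        using \<open>z \<in> ?U\<close> assms(2) by (simp add: power_mult_distrib power_inverse)
      finally show ?thesis using False by simp
    qed
  qed
  also have "\<dots> = of_nat L * c w"
    using assms finite_roots[OF assms(1)] by simp
  finally show ?thesis .
qed

text \<open>The powers of 1 / w sum to 0 over L terms, so pairing a constant with them gives 0,
  whereas orthogonality gives L times \<open>c w\<close>.\<close>

lemma constant_Fourier_coeff:
  fixes w :: complex
  assumes "0 < L" "w ^ L = 1" "w \<noteq> 1" "\<And>t. (\<Sum>z | z ^ L = 1. c z * z ^ t) = d"
  shows "c w = 0"
proof -
  have "(\<Sum>t<L. d * inverse w ^ t) = of_nat L * c w"
    using sum_orthogonality[OF assms(1,2), of c] by (simp add: assms(4))
  moreover have "(\<Sum>t<L. d * inverse w ^ t) = d * (\<Sum>t<L. inverse w ^ t)"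
    by (simp add: sum_distrib_left)
  moreover have "inverse w \<noteq> 1" using assms(3) by simp
  then have "(\<Sum>t<L. inverse w ^ t) = 0"
    using assms(2) by (subst geometric_sum) (simp_all only: power_inverse, simp_all)
  ultimately show ?thesis using assms(1) by simp
qed

text \<open>Sorting the expansion by powers of t gives a complex quasi-polynomial, and uniqueness
  identifies every E with it in the relevant degrees. Its real part proves existence, since the
  denumerant is real.\<close>

lemma denumerant_coeffs_Fourier:
  assumes "as \<noteq> []" "\<forall>a\<in>set as. 0 < a"
  shows "\<exists>P L. 0 < L \<and> (\<forall>a\<in>set as. a dvd L) \<and>
    (\<forall>z k. pole_order z as \<le> k \<longrightarrow> coeff (P z) k = 0) \<and>
    (\<forall>z. z ^ last as = 1 \<longrightarrow> coeff (P z) (pole_order z as - 1) \<noteq> 0) \<and>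
    (\<forall>E i t. denumerant_coeffs as E \<longrightarrow> i \<le> length as - 1 \<longrightarrow>
       complex_of_real (E i t) = (\<Sum>z | z ^ L = 1. coeff (P z) i * z ^ t)) \<and>
    denumerant_coeffs as (\<lambda>i t. Re (\<Sum>z | z ^ L = 1. coeff (P z) i * z ^ t))"
proof -
  define L where "L = (\<Prod>a\<in>set as. a)"
  have L: "0 < L" using assms(2) unfolding L_def by (intro prod_pos) auto
  have dvd: "\<forall>a\<in>set as. a dvd L" unfolding L_def by (auto intro: dvd_prodI)
  from denumerant_expansion[OF assms L dvd] obtain P :: "complex \<Rightarrow> complex poly" where
    P: "\<And>t. of_nat (denumerant as t) = (\<Sum>z | z ^ L = 1. poly (P z) (of_nat t) * z ^ t)"
    and P0: "\<And>z k. pole_order z as \<le> k \<Longrightarrow> coeff (P z) k = 0"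
    and Pl: "\<And>z. z ^ last as = 1 \<Longrightarrow> coeff (P z) (pole_order z as - 1) \<noteq> 0" by blast
  let ?N = "length as - 1"
  define G where "G i t = (\<Sum>z | z ^ L = 1. coeff (P z) i * z ^ t)" for i t
  have sum_G: "(\<Sum>i\<le>?N. G i t * of_nat t ^ i) = of_nat (denumerant as t)" for t
  proof -
    have poly: "poly (P z) x = (\<Sum>i\<le>?N. coeff (P z) i * x ^ i)" for z x
    proof -
      have "pole_order z as \<le> length as" by (simp add: pole_order_def)
      then have "degree (P z) \<le> ?N" using P0 by (intro degree_le) auto
      then have "poly (P z) x = poly (\<Sum>i\<le>?N. monom (coeff (P z) i) i) x"
        by (simp only: poly_as_sum_of_monoms')
      then show ?thesis by (simp add: poly_sum poly_monom)
    qed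
    show ?thesis
      unfolding P poly G_def sum_distrib_right
      by (subst sum.swap) (simp add: mult_ac)
  qed
  have G_per: "periodic (G i)" for i
    unfolding periodic_def using L by (intro exI[of _ L]) (simp add: G_def power_add)
  have "complex_of_real (E i t) = G i t" if "denumerant_coeffs as E" "i \<le> ?N" for E i t
  proof (rule quasi_polynomial_unique[OF _ _ _ that(2)])
    show "\<forall>i\<le>?N. periodic (\<lambda>t. complex_of_real (E i t))"
      using that(1) by (auto simp: denumerant_coeffs_def periodic_def)
    show "\<forall>i\<le>?N. periodic (G i)" using G_per by blast
    fix t
    have "(\<Sum>i\<le>?N. complex_of_real (E i t) * of_nat t ^ i) = complex_of_real (\<Sum>i\<le>?N. E i t * real t ^ i)"
      by simp
    also have "(\<Sum>i\<le>?N. E i t * real t ^ i) = real (denumerant as t)"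
      using that(1) by (simp add: denumerant_coeffs_def)
    also have "complex_of_real \<dots> = (\<Sum>i\<le>?N. G i t * of_nat t ^ i)"
      by (simp only: sum_G of_real_of_nat_eq)
    finally show "(\<Sum>i\<le>?N. complex_of_real (E i t) * of_nat t ^ i) = (\<Sum>i\<le>?N. G i t * of_nat t ^ i)" .
  qed
  moreover have "denumerant_coeffs as (\<lambda>i t. Re (G i t))"
    unfolding denumerant_coeffs_def
  proof (intro conjI allI impI)
    show "periodic (\<lambda>t. Re (G i t))" for i
      using G_per[of i] by (auto simp: periodic_def)
    fix t
    have "Re (G i t) * real t ^ i = Re (G i t * of_nat t ^ i)" for i
    proof -
      have "of_nat t ^ i = complex_of_real (real t ^ i)" by simp
      then show ?thesis by (simp only: times_complex.sel Re_complex_of_real Im_complex_of_real)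
    qed
    then have "(\<Sum>i\<le>?N. Re (G i t) * real t ^ i) = Re (\<Sum>i\<le>?N. G i t * of_nat t ^ i)" by simp
    then show "real (denumerant as t) = (\<Sum>i\<le>?N. Re (G i t) * real t ^ i)"
      by (simp only: sum_G complex_Re_of_nat)
  qed
  ultimately show ?thesis
    unfolding G_def using L dvd P0 Pl by (intro exI[of _ P] exI[of _ L] conjI) simp_all
qed

section \<open>Constant and non-constant coefficients\<close>

lemma coefficient_constant:
  assumes "admissible as" "denumerant_coeffs as E" "ell as \<le> m" "m \<le> length as - 1"
  shows "constant_fun (E m)"
proof -
  have as: "as \<noteq> []" "\<forall>a\<in>set as. 0 < a" using assms(1) by (auto simp: admissible_def)
  from denumerant_coeffs_Fourier[OF as] obtain P L where L: "0 < L"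
    and P0: "\<forall>z k. pole_order z as \<le> k \<longrightarrow> coeff (P z) k = 0"
    and E: "\<forall>E i t. denumerant_coeffs as E \<longrightarrow> i \<le> length as - 1 \<longrightarrow>
       complex_of_real (E i t) = (\<Sum>z | z ^ L = 1. coeff (P z) i * z ^ t)"
    by (elim exE conjE)
  have "complex_of_real (E m t) = coeff (P 1) m" for t
  proof -
    have P0': "coeff (P z) m = 0" if "z \<noteq> 1" for z
      using P0 pole_order_le_ell[OF assms(1) that] assms(3) by simp
    have "(\<Sum>z | z ^ L = 1. coeff (P z) m * z ^ t) = (\<Sum>z | z ^ L = (1::complex). if z = 1 then coeff (P 1) m else 0)"
      by (intro sum.cong) (auto simp: P0')
    then show ?thesis using E assms(2,4) finite_roots[OF L] by simp
  qed
  then have "\<forall>t. E m t = Re (coeff (P 1) m)" by (metis Re_complex_of_real)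
  then show ?thesis unfolding constant_fun_def by blast
qed

text \<open>The Fourier coefficient of this function at w is the leading coefficient of
  \<open>P w\<close>, which is nonzero; a constant function has none there.\<close>

lemma coefficient_not_constant:
  assumes "as \<noteq> []" "\<forall>a\<in>set as. 0 < a" "denumerant_coeffs as E"
    and "w \<noteq> 1" "w ^ last as = 1"
  shows "\<not> constant_fun (E (pole_order w as - 1))"
proof
  from denumerant_coeffs_Fourier[OF assms(1,2)] obtain P L where L: "0 < L"
    and dvd: "\<forall>a\<in>set as. a dvd L"
    and Pl: "\<forall>z. z ^ last as = 1 \<longrightarrow> coeff (P z) (pole_order z as - 1) \<noteq> 0"
    and E: "\<forall>E i t. denumerant_coeffs as E \<longrightarrow> i \<le> length as - 1 \<longrightarrow>
       complex_of_real (E i t) = (\<Sum>z | z ^ L = 1. coeff (P z) i * z ^ t)"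
    by (elim exE conjE)
  let ?m = "pole_order w as - 1"
  have m: "?m \<le> length as - 1" by (simp add: pole_order_def diff_le_mono)
  have w: "w ^ L = 1"
    using dvd last_in_set[OF assms(1)] assms(5) by (auto elim!: dvdE simp: power_mult)
  assume "constant_fun (E ?m)"
  then obtain d where "\<And>t. E ?m t = d" by (auto simp: constant_fun_def)
  then have "(\<Sum>z | z ^ L = 1. coeff (P z) ?m * z ^ t) = complex_of_real d" for t
    using E assms(3) m by metis
  from constant_Fourier_coeff[OF L w assms(4) this] Pl assms(5) show False by blast
qed

lemma coefficient_ell_not_constant:
  assumes "admissible as" "denumerant_coeffs as E"
  shows "\<not> constant_fun (E (ell as - 1))"
proof -
  have pos: "\<forall>a\<in>set as. 0 < a" using assms(1) by (simp add: admissible_def)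
  obtain w where w: "w \<noteq> 1" "pole_order w as = ell as" "0 < ell as"
    using pole_order_ell[OF assms(1)] .
  then have "filter (\<lambda>a. w ^ a = 1) as \<noteq> []" by (auto simp: pole_order_def)
  then obtain a where a: "a \<in> set as" "w ^ a = 1" by (auto simp: filter_empty_conv)
  \<comment> \<open>Non-vanishing is available only where the last entry contributes to the pole, so
    an entry with w^a = 1 is moved to the end. Length, pole orders and denumerant are
    unaffected.\<close>
  define bs where "bs = remove1 a as @ [a]"
  have mset: "mset bs = mset as" using a(1) by (simp add: bs_def)
  have "length bs = length as" "set bs = set as" using mset by (metis size_mset, metis mset_eq_setD)
  moreover have "pole_order w bs = pole_order w as"
    unfolding pole_order_def using mset by (metis mset_filter size_mset)
  moreover have "denumerant bs = denumerant as"
    using mset pos calculation(2) by (intro denumerant_mset_cong) auto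
  ultimately show ?thesis
    using coefficient_not_constant[of bs E w] w a(2) assms(2) pos
    by (auto simp: denumerant_coeffs_def bs_def)
qed

section \<open>A machine counting equal fields\<close>

text \<open>Asking for at most n steps, not exactly n, lets time bounds be weakened freely.\<close>

definition reach :: "tm \<Rightarrow> nat \<Rightarrow> config \<Rightarrow> config \<Rightarrow> bool" where
  "reach M n c c' \<longleftrightarrow> (\<exists>k\<le>n. (step M ^^ k) c = c')"

lemma reach_refl: "reach M n c c"
  by (auto simp: reach_def intro: exI[of _ 0])

lemma reach_mono: "reach M n c c' \<Longrightarrow> n \<le> n' \<Longrightarrow> reach M n' c c'"
  unfolding reach_def using le_trans by blast

lemma reach_trans: "reach M n a b \<Longrightarrow> reach M m b c \<Longrightarrow> reach M (n + m) a c"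
  unfolding reach_def
proof safe
  fix k l assume "k \<le> n" "l \<le> m"
  then show "\<exists>ka\<le>n + m. (step M ^^ ka) a = (step M ^^ l) ((step M ^^ k) a)"
    by (intro exI[of _ "l + k"]) (simp add: funpow_add)
qed

lemma reach_Suc: "reach M n (step M a) c \<Longrightarrow> reach M (Suc n) a c"
  unfolding reach_def by (metis Suc_le_mono comp_apply funpow_Suc_right)

lemma reach_step: "reach M (Suc 0) a (step M a)"
  by (rule reach_Suc, rule reach_refl)

text \<open>
  Tape 2 receives a copy of the input, so that the field under head 0 can be compared with every
  field under head 2; tape 3 counts the matches in unary. Since tape 3 is never erased between two
  outer passes, it ends up holding the maximum of all counts, which states 8 to 10 convert to binary.
  \<^item> 0: copy tape 0 to tape 2; 1: rewind both;
  \<^item> 2: move head 0 to the next separator 4 (outer loop); 3: move head 2 to the next 4 (inner loop);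
  \<^item> 4: compare the two fields; 5: return head 0 to the separator it started from;
  \<^item> 6, 7: rewind tapes 2 and 3 after an inner loop;
  \<^item> 8: consume one unary digit; 9: increment tape 1; 10: rewind tape 1.
\<close>

definition count_delta :: "nat \<Rightarrow> nat list \<Rightarrow> nat \<times> (nat \<times> move) list" where
  "count_delta q ss = (let x = ss ! 0; b = ss ! 1; y = ss ! 2; u = ss ! 3 in
     if q = 0 then
       if x \<noteq> 0 then (0, [(x, Right), (b, Stay), (x, Right), (u, Stay)])
       else (1, [(x, Left), (b, Stay), (y, Left), (u, Stay)])
     else if q = 1 then
       if x \<noteq> 0 then (1, [(x, Left), (b, Stay), (y, Left), (u, Stay)])
       else (2, [(x, Right), (b, Stay), (y, Right), (u, Stay)])
     else if q = 2 then
       if x = 4 then (3, [(x, Stay), (b, Stay), (y, Stay), (u, Stay)])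
       else if x = 0 then (8, [(x, Stay), (b, Stay), (y, Stay), (u, Stay)])
       else (2, [(x, Right), (b, Stay), (y, Stay), (u, Stay)])
     else if q = 3 then
       if y = 4 then (4, [(x, Right), (b, Stay), (y, Right), (u, Stay)])
       else if y = 0 then (6, [(x, Stay), (b, Stay), (y, Left), (u, Left)])
       else (3, [(x, Stay), (b, Stay), (y, Right), (u, Stay)])
     else if q = 4 then
       if x = y \<and> x \<in> {1, 2} then (4, [(x, Right), (b, Stay), (y, Right), (u, Stay)])
       else if x = y \<and> x = 3 then (5, [(x, Left), (b, Stay), (y, Stay), (1, Right)])
       else (5, [(x, Left), (b, Stay), (y, Stay), (u, Stay)])
     else if q = 5 then
       if x = 4 then (3, [(x, Stay), (b, Stay), (y, Stay), (u, Stay)])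
       else (5, [(x, Left), (b, Stay), (y, Stay), (u, Stay)])
     else if q = 6 then
       if y \<noteq> 0 then (6, [(x, Stay), (b, Stay), (y, Left), (u, Stay)])
       else (7, [(x, Stay), (b, Stay), (y, Right), (u, Stay)])
     else if q = 7 then
       if u \<noteq> 0 then (7, [(x, Stay), (b, Stay), (y, Stay), (u, Left)])
       else (2, [(x, Right), (b, Stay), (y, Stay), (u, Right)])
     else if q = 8 then
       if u \<noteq> 0 then (9, [(x, Stay), (b, Stay), (y, Stay), (u, Right)])
       else (11, [(x, Stay), (b, Stay), (y, Stay), (u, Stay)])
     else if q = 9 then
       if b = 2 then (9, [(x, Stay), (1, Right), (y, Stay), (u, Stay)])
       else (10, [(x, Stay), (2, Left), (y, Stay), (u, Stay)])
     else
       if b \<noteq> 0 then (10, [(x, Stay), (b, Left), (y, Stay), (u, Stay)])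
       else (8, [(x, Stay), (b, Right), (y, Stay), (u, Stay)]))"

definition count_tm :: tm where
  "count_tm = \<lparr>tapes = 4, states = 11, symbols = 6, delta = count_delta\<rparr>"

lemma count_tm_sel [simp]:
  "tapes count_tm = 4" "states count_tm = 11" "symbols count_tm = 6" "delta count_tm = count_delta"
  by (simp_all add: count_tm_def)

lemma wf_count_tm: "wf_tm count_tm"
proof -
  have "case count_delta q ss of (q', acts) \<Rightarrow>
      q' \<le> 11 \<and> length acts = 4 \<and> fst ` set acts \<subseteq> {..<6}"
    if "length ss = 4" "set ss \<subseteq> {..<6}" for q ss
  proof -
    have "ss ! k < 6" if "k < 4" for k
      using that \<open>length ss = 4\<close> \<open>set ss \<subseteq> {..<6}\<close> nth_mem[of k ss]
      by (metis lessThan_iff subset_eq)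
    from this[of 0] this[of 1] this[of 2] this[of 3] show ?thesis
      by (simp add: count_delta_def Let_def)
  qed
  then show ?thesis
    by (simp add: wf_tm_def)
qed

lemma nth_four_list: "[a, b, c, d] ! 0 = a" "[a, b, c, d] ! 1 = b" "[a, b, c, d] ! 2 = c" "[a, b, c, d] ! 3 = d"
  by (simp_all add: numeral_eq_Suc)

section \<open>The effect of one step in each state\<close>

context
  fixes f0 f1 f2 f3 :: "int \<Rightarrow> nat" and h0 h1 h2 h3 :: int
begin

lemmas step_simps = count_delta_def Let_def nth_four_list

lemma step_copy: "step count_tm (0, [(f0, h0), (f1, h1), (f2, h2), (f3, h3)]) =
  (if f0 h0 \<noteq> 0 then (0, [(f0, h0 + 1), (f1, h1), (f2(h2 := f0 h0), h2 + 1), (f3, h3)])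
   else (1, [(f0, h0 - 1), (f1, h1), (f2, h2 - 1), (f3, h3)]))"
  by (auto simp: step_simps fun_upd_idem)

lemma step_rewind_both: "step count_tm (1, [(f0, h0), (f1, h1), (f2, h2), (f3, h3)]) =
  (if f0 h0 \<noteq> 0 then (1, [(f0, h0 - 1), (f1, h1), (f2, h2 - 1), (f3, h3)])
   else (2, [(f0, h0 + 1), (f1, h1), (f2, h2 + 1), (f3, h3)]))"
  by (auto simp: step_simps fun_upd_idem)

lemma step_seek: "step count_tm (2, [(f0, h0), (f1, h1), (f2, h2), (f3, h3)]) =
  (if f0 h0 = 4 then (3, [(f0, h0), (f1, h1), (f2, h2), (f3, h3)])
   else if f0 h0 = 0 then (8, [(f0, h0), (f1, h1), (f2, h2), (f3, h3)])
   else (2, [(f0, h0 + 1), (f1, h1), (f2, h2), (f3, h3)]))"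
  by (auto simp: step_simps fun_upd_idem)

lemma step_scan: "step count_tm (3, [(f0, h0), (f1, h1), (f2, h2), (f3, h3)]) =
  (if f2 h2 = 4 then (4, [(f0, h0 + 1), (f1, h1), (f2, h2 + 1), (f3, h3)])
   else if f2 h2 = 0 then (6, [(f0, h0), (f1, h1), (f2, h2 - 1), (f3, h3 - 1)])
   else (3, [(f0, h0), (f1, h1), (f2, h2 + 1), (f3, h3)]))"
  by (auto simp: step_simps fun_upd_idem)

lemma step_compare: "step count_tm (4, [(f0, h0), (f1, h1), (f2, h2), (f3, h3)]) =
  (if f0 h0 = f2 h2 \<and> f0 h0 \<in> {1, 2} then (4, [(f0, h0 + 1), (f1, h1), (f2, h2 + 1), (f3, h3)])
   else if f0 h0 = f2 h2 \<and> f0 h0 = 3 then (5, [(f0, h0 - 1), (f1, h1), (f2, h2), (f3(h3 := 1), h3 + 1)])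
   else (5, [(f0, h0 - 1), (f1, h1), (f2, h2), (f3, h3)]))"
  by (auto simp: step_simps fun_upd_idem)

lemma step_return: "step count_tm (5, [(f0, h0), (f1, h1), (f2, h2), (f3, h3)]) =
  (if f0 h0 = 4 then (3, [(f0, h0), (f1, h1), (f2, h2), (f3, h3)])
   else (5, [(f0, h0 - 1), (f1, h1), (f2, h2), (f3, h3)]))"
  by (auto simp: step_simps fun_upd_idem)

lemma step_rewind_copy: "step count_tm (6, [(f0, h0), (f1, h1), (f2, h2), (f3, h3)]) =
  (if f2 h2 \<noteq> 0 then (6, [(f0, h0), (f1, h1), (f2, h2 - 1), (f3, h3)])
   else (7, [(f0, h0), (f1, h1), (f2, h2 + 1), (f3, h3)]))"
  by (auto simp: step_simps fun_upd_idem)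

lemma step_rewind_counter: "step count_tm (7, [(f0, h0), (f1, h1), (f2, h2), (f3, h3)]) =
  (if f3 h3 \<noteq> 0 then (7, [(f0, h0), (f1, h1), (f2, h2), (f3, h3 - 1)])
   else (2, [(f0, h0 + 1), (f1, h1), (f2, h2), (f3, h3 + 1)]))"
  by (auto simp: step_simps fun_upd_idem)

lemma step_convert: "step count_tm (8, [(f0, h0), (f1, h1), (f2, h2), (f3, h3)]) =
  (if f3 h3 \<noteq> 0 then (9, [(f0, h0), (f1, h1), (f2, h2), (f3, h3 + 1)])
   else (11, [(f0, h0), (f1, h1), (f2, h2), (f3, h3)]))"
  by (auto simp: step_simps fun_upd_idem)

lemma step_increment: "step count_tm (9, [(f0, h0), (f1, h1), (f2, h2), (f3, h3)]) =
  (if f1 h1 = 2 then (9, [(f0, h0), (f1(h1 := 1), h1 + 1), (f2, h2), (f3, h3)])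
   else (10, [(f0, h0), (f1(h1 := 2), h1 - 1), (f2, h2), (f3, h3)]))"
  by (auto simp: step_simps fun_upd_idem)

lemma step_rewind_output: "step count_tm (10, [(f0, h0), (f1, h1), (f2, h2), (f3, h3)]) =
  (if f1 h1 \<noteq> 0 then (10, [(f0, h0), (f1, h1 - 1), (f2, h2), (f3, h3)])
   else (8, [(f0, h0), (f1, h1 + 1), (f2, h2), (f3, h3)]))"
  by (auto simp: step_simps fun_upd_idem)

end

lemma word_cells_int [simp]: "word_cells w (int i) = (if i < length w then w ! i else 0)"
  by (simp add: word_cells_def)

lemma word_cells_neg [simp]: "word_cells w (- 1) = 0"
  by (simp add: word_cells_def)

text \<open>With \<open>drop 1\<close> one equation covers both overwriting the first symbol of v
  and, for empty v, extending the word by a cell.\<close>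

lemma word_cells_append_upd:
  "(word_cells (u @ v))(int (length u) := x) = word_cells (u @ x # drop 1 v)"
  by (auto simp: word_cells_def fun_eq_iff nth_append nth_Cons' nat_eq_iff split: if_splits
    intro!: arg_cong[where f = "(!) v"])

text \<open>
  Only prime fields are terminated by the symbol 3, so the fields counted here are exactly the
  prime fields.
\<close>

fun same_field :: "nat list \<Rightarrow> nat list \<Rightarrow> bool" where
  "same_field (x # u) (y # v) \<longleftrightarrow> x = y \<and> (x = 3 \<or> x \<in> {1, 2} \<and> same_field u v)"
| "same_field _ _ \<longleftrightarrow> False"

text \<open>Here u is the text behind the separator under head 0; every 4 in the second word opens a
  field to compare with the start of u.\<close>

fun field_count :: "nat list \<Rightarrow> nat list \<Rightarrow> nat" where
  "field_count u [] = 0"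
| "field_count u (x # v) = (if x = 4 \<and> same_field u v then 1 else 0) + field_count u v"

fun max_count :: "nat list \<Rightarrow> nat list \<Rightarrow> nat" where
  "max_count w [] = 0"
| "max_count w (x # v) = max (if x = 4 then field_count v w else 0) (max_count w v)"

lemma field_count_le: "field_count u v \<le> length v"
  by (induction v) auto

lemma max_count_le: "max_count w v \<le> length w"
  by (induction v) (auto intro: field_count_le)

text \<open>The cells that head 2 passes during a comparison contain no 4, so no field is missed
  when the scan resumes behind them.\<close>

lemma field_count_drop:
  assumes "\<forall>k<d. w ! (j + k) \<noteq> 4" "j + d \<le> length w"
  shows "field_count u (drop j w) = field_count u (drop (j + d) w)"
  using assms
proof (induction d)
  case (Suc d)
  then have "drop (j + d) w = w ! (j + d) # drop (j + Suc d) w" "w ! (j + d) \<noteq> 4"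
    by (auto simp: Cons_nth_drop_Suc)
  then show ?case using Suc by simp
qed simp

text \<open>The count of the current pass is c, the position of head 3; the largest count so far is
  m, the number of ones on tape 3.\<close>

abbreviation main_cfg :: "nat list \<Rightarrow> nat \<Rightarrow> int \<Rightarrow> int \<Rightarrow> int \<Rightarrow> nat \<Rightarrow> config" where
  "main_cfg w q i j c m \<equiv>
     (q, [(word_cells w, i), (word_cells [], 0), (word_cells w, j), (word_cells (replicate m 1), c)])"

text \<open>This is how tape 3 computes a maximum: a one written inside the block changes nothing,
  and only a write at cell m extends it.\<close>

lemma counter_upd:
  assumes "c \<le> m"
  shows "(word_cells (replicate m (Suc 0)))(int c := Suc 0) = word_cells (replicate (max m (Suc c)) (Suc 0))"
  using assms by (auto simp: word_cells_def fun_eq_iff)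

text \<open>The witness d is the number of equal digits passed. Head 0 steps back on leaving state
  4, hence i + d - 1. The clause d = 0 is separate because i and j may then lie beyond the
  word.\<close>

lemma count_tm_compare:
  assumes "c \<le> m" "0 \<notin> set w"
  shows "\<exists>d. reach count_tm (Suc d) (main_cfg w 4 (int i) (int j) (int c) m)
      (let b = same_field (drop i w) (drop j w) in
        main_cfg w 5 (int i + int d - 1) (int (j + d)) (int (if b then Suc c else c))
          (if b then max m (Suc c) else m)) \<and>
    (\<forall>k<d. w ! (i + k) \<noteq> 4) \<and> (\<forall>k<d. w ! (j + k) \<noteq> 4) \<and>
    (d = 0 \<or> i + d \<le> length w \<and> j + d \<le> length w)"
proof (induction "length w - j" arbitrary: i j rule: less_induct)
  case less
  let ?x = "word_cells w (int i)" and ?y = "word_cells w (int j)"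
  consider (eq) "?x = ?y" "?x \<in> {1, 2}" | (three) "?x = ?y" "?x = 3"
    | (no) "\<not> (?x = ?y \<and> ?x \<in> {1, 2, 3})"
    unfolding insert_iff empty_iff by metis
  then show ?case
  proof cases
    case eq
    then have i: "i < length w" and j: "j < length w" by (auto split: if_splits)
    have "length w - Suc j < length w - j" using j by simp
    from less[OF this, of "Suc i"] obtain d where d: "reach count_tm (Suc d) (main_cfg w 4 (int (Suc i)) (int (Suc j)) (int c) m)
      (let b = same_field (drop (Suc i) w) (drop (Suc j) w) in
        main_cfg w 5 (int (Suc i) + int d - 1) (int (Suc j + d)) (int (if b then Suc c else c))
          (if b then max m (Suc c) else m))"
     "\<forall>k<d. w ! (Suc i + k) \<noteq> 4" "\<forall>k<d. w ! (Suc j + k) \<noteq> 4"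
     "d = 0 \<or> Suc i + d \<le> length w \<and> Suc j + d \<le> length w" by blast
    have s: "same_field (drop i w) (drop j w) = same_field (drop (Suc i) w) (drop (Suc j) w)"
      using eq i j by (auto simp flip: Cons_nth_drop_Suc)
    have "reach count_tm (Suc (Suc d)) (main_cfg w 4 (int i) (int j) (int c) m)
      (let b = same_field (drop i w) (drop j w) in
        main_cfg w 5 (int i + int (Suc d) - 1) (int (j + Suc d)) (int (if b then Suc c else c))
          (if b then max m (Suc c) else m))"
      by (rule reach_Suc, subst step_compare) (use d(1) eq in \<open>simp add: s add.commute\<close>)
    moreover have "\<forall>k<Suc d. w ! (i + k) \<noteq> 4"
      using d(2) eq i j by (auto simp: All_less_Suc2)
    moreover have "\<forall>k<Suc d. w ! (j + k) \<noteq> 4"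
      using d(3) eq i j by (auto simp: All_less_Suc2)
    ultimately show ?thesis using d(4) i j by (intro exI[of _ "Suc d"]) auto
  next
    case three
    then have i: "i < length w" and j: "j < length w" by (auto split: if_splits)
    have s: "same_field (drop i w) (drop j w)"
      using three i j by (auto simp flip: Cons_nth_drop_Suc)
    show ?thesis
      by (rule exI[of _ 0], intro conjI, rule reach_Suc, subst step_compare)
        (use three s assms in \<open>simp_all add: reach_refl counter_upd add.commute\<close>)
  next
    case no
    then have s: "\<not> same_field (drop i w) (drop j w)"
      by (cases "i < length w"; cases "j < length w") (auto simp flip: Cons_nth_drop_Suc)
    show ?thesis
      by (rule exI[of _ 0], intro conjI, rule reach_Suc, subst step_compare)
        (use no s in \<open>auto simp add: reach_refl\<close>)
  qed
qed

lemma count_tm_return: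
  assumes "i < length w" "w ! i = 4" "i + d < length w" "\<forall>k<d. w ! (Suc i + k) \<noteq> 4"
  shows "reach count_tm (Suc d) (main_cfg w 5 (int i + int d) j c m) (main_cfg w 3 (int i) j c m)"
  using assms(3,4)
proof (induction d)
  case 0
  then show ?case using assms
    by (intro reach_Suc, subst step_return) (simp add: reach_refl)
next
  case (Suc d)
  have w: "word_cells w (int i + int (Suc d)) \<noteq> 4"
    using Suc.prems by (simp add: word_cells_def nat_add_distrib)
  show ?case
    by (rule reach_Suc, subst step_return) (use w Suc in auto)
qed

text \<open>Each round passes at least one cell of tape 2, and a comparison with its return costs at
  most 2 d + 3 steps with d below the length of w.\<close>

lemma count_tm_scan:
  assumes "0 \<notin> set w" "i < length w" "w ! i = 4"
  shows "c \<le> m \<Longrightarrow> j \<le> length w \<Longrightarrow>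
    (let k = c + field_count (drop (Suc i) w) (drop j w) in
     reach count_tm ((length w - j) * (2 * length w + 5)) (main_cfg w 3 (int i) (int j) (int c) m)
       (main_cfg w 3 (int i) (int (length w)) (int k) (max m k)))"
proof (induction "length w - j" arbitrary: j c m rule: less_induct)
  case less
  show ?case
  proof (cases "j < length w")
    case False
    with less.prems show ?thesis by (simp add: reach_refl max_def)
  next
    case j: True
    show ?thesis
    proof (cases "w ! j = 4")
      case False
      have "w ! j \<noteq> 0" using assms(1) j nth_mem by metis
      have "length w - Suc j < length w - j" using j by simp
      from less.hyps[OF this less.prems(1)] j
      have *: "let k = c + field_count (drop (Suc i) w) (drop (Suc j) w) in
        reach count_tm ((length w - Suc j) * (2 * length w + 5)) (main_cfg w 3 (int i) (int (Suc j)) (int c) m)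
       (main_cfg w 3 (int i) (int (length w)) (int k) (max m k))" by simp
      have e: "field_count (drop (Suc i) w) (drop (Suc j) w) = field_count (drop (Suc i) w) (drop j w)"
        using j False by (simp flip: Cons_nth_drop_Suc)
      have s: "step count_tm (main_cfg w 3 (int i) (int j) (int c) m) = main_cfg w 3 (int i) (int (Suc j)) (int c) m"
        by (subst step_scan) (use j False \<open>w ! j \<noteq> 0\<close> in \<open>simp add: add.commute\<close>)
      have le: "Suc ((length w - Suc j) * (2 * length w + 5)) \<le> (length w - j) * (2 * length w + 5)"
        using j by (simp add: Suc_diff_Suc[symmetric])
      show ?thesis unfolding Let_def
        by (rule reach_mono[OF reach_Suc le], subst s) (use * in \<open>simp only: Let_def e\<close>)
    next
      case True
      let ?b = "same_field (drop (Suc i) w) (drop (Suc j) w)"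
      define c' where "c' = (if ?b then Suc c else c)"
      define m' where "m' = (if ?b then max m (Suc c) else m)"
      from count_tm_compare[OF less.prems(1) assms(1), of "Suc i" "Suc j"]
      obtain d where d: "reach count_tm (Suc d) (main_cfg w 4 (int (Suc i)) (int (Suc j)) (int c) m)
          (main_cfg w 5 (int (Suc i) + int d - 1) (int (Suc j + d)) (int c') m')"
        "\<forall>k<d. w ! (Suc i + k) \<noteq> 4" "\<forall>k<d. w ! (Suc j + k) \<noteq> 4"
        "d = 0 \<or> Suc i + d \<le> length w \<and> Suc j + d \<le> length w"
        unfolding Let_def c'_def m'_def by blast
      have 1: "reach count_tm 1 (main_cfg w 3 (int i) (int j) (int c) m)
          (main_cfg w 4 (int (Suc i)) (int (Suc j)) (int c) m)"
        using reach_step[of count_tm "main_cfg w 3 (int i) (int j) (int c) m"] j True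
        by (subst (asm) step_scan) (simp add: add.commute)
      have idl: "i + d < length w" and jdl: "Suc j + d \<le> length w" using d(4) assms(2) j by auto
      have 2: "reach count_tm (Suc d) (main_cfg w 5 (int (Suc i) + int d - 1) (int (Suc j + d)) (int c') m')
          (main_cfg w 3 (int i) (int (Suc j + d)) (int c') m')"
        using count_tm_return[OF assms(2,3) idl d(2)] by simp
      have "c' \<le> m'" using less.prems(1) by (auto simp: c'_def m'_def)
      have "length w - (Suc j + d) < length w - j" using j by simp
      from less.hyps[OF this \<open>c' \<le> m'\<close> jdl]
      have 3: "let k = c' + field_count (drop (Suc i) w) (drop (Suc j + d) w) in
        reach count_tm ((length w - (Suc j + d)) * (2 * length w + 5)) (main_cfg w 3 (int i) (int (Suc j + d)) (int c') m')
       (main_cfg w 3 (int i) (int (length w)) (int k) (max m' k))" .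
      have e: "c' + field_count (drop (Suc i) w) (drop (Suc j + d) w) = c + field_count (drop (Suc i) w) (drop j w)"
        using field_count_drop[OF d(3) jdl, of "drop (Suc i) w"] j True
        by (simp add: c'_def flip: Cons_nth_drop_Suc)
      \<comment> \<open>If m was raised to c + 1, the final count is at least that large, so the
        maximum is the same.\<close>
      have e2: "max m' (c + field_count (drop (Suc i) w) (drop j w)) = max m (c + field_count (drop (Suc i) w) (drop j w))"
        using e by (auto simp: m'_def c'_def split: if_splits)
      have le: "1 + Suc d + Suc d + (length w - (Suc j + d)) * (2 * length w + 5) \<le> (length w - j) * (2 * length w + 5)"
      proof -
        have "1 + Suc d + Suc d \<le> 2 * length w + 5" using idl by simp
        moreover have "(length w - (Suc j + d)) * (2 * length w + 5) \<le> (length w - Suc j) * (2 * length w + 5)"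
          by (intro mult_right_mono) auto
        moreover have "(length w - j) * (2 * length w + 5) = (2 * length w + 5) + (length w - Suc j) * (2 * length w + 5)"
          using j by (simp add: Suc_diff_Suc[symmetric])
        ultimately show ?thesis by linarith
      qed
      show ?thesis
        unfolding Let_def
        using reach_mono[OF reach_trans[OF reach_trans[OF reach_trans[OF 1 d(1)] 2] 3[unfolded Let_def e e2]] le] .
    qed
  qed
qed

text \<open>The blank at cell -1 marks the left end; with the position written as j - 1, the case j
  = 0 has the head already there.\<close>

lemma count_tm_rewind_copy:
  assumes "0 \<notin> set w"
  shows "j \<le> length w \<Longrightarrow> reach count_tm (Suc j) (main_cfg w 6 i (int j - 1) c m) (main_cfg w 7 i 0 c m)"
proof (induction j)
  case 0
  show ?case by (rule reach_Suc, subst step_rewind_copy) (simp add: reach_refl)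
next
  case (Suc j)
  then have "w ! j \<noteq> 0" using assms by (metis Suc_le_lessD nth_mem)
  show ?case
    by (rule reach_Suc, subst step_rewind_copy) (use Suc \<open>w ! j \<noteq> 0\<close> in simp)
qed

lemma count_tm_rewind_counter:
  "c \<le> m \<Longrightarrow> reach count_tm (Suc c) (main_cfg w 7 i j (int c - 1) m) (main_cfg w 2 (i + 1) j 0 m)"
proof (induction c)
  case 0
  show ?case by (rule reach_Suc, subst step_rewind_counter) (simp add: reach_refl)
next
  case (Suc c)
  show ?case
    by (rule reach_Suc, subst step_rewind_counter) (use Suc in simp)
qed

lemma count_tm_outer_pass:
  assumes "0 \<notin> set w" "i < length w" "w ! i = 4"
  shows "reach count_tm (length w * (2 * length w + 5) + 2 * length w + 4)
    (main_cfg w 2 (int i) 0 0 m)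
    (main_cfg w 2 (int (Suc i)) 0 0 (max m (field_count (drop (Suc i) w) w)))"
proof -
  let ?k = "field_count (drop (Suc i) w) w"
  let ?n = "length w" and ?m = "max m ?k"
  have 1: "reach count_tm 1 (main_cfg w 2 (int i) 0 0 m) (main_cfg w 3 (int i) 0 0 m)"
    using reach_step[of count_tm "main_cfg w 2 (int i) 0 0 m"] assms
    by (subst (asm) step_seek) simp
  have 2: "reach count_tm (?n * (2 * ?n + 5)) (main_cfg w 3 (int i) 0 0 m) (main_cfg w 3 (int i) (int ?n) (int ?k) ?m)"
    using count_tm_scan[OF assms, of 0 m 0] by (simp add: Let_def)
  have 3: "reach count_tm 1 (main_cfg w 3 (int i) (int ?n) (int ?k) ?m) (main_cfg w 6 (int i) (int ?n - 1) (int ?k - 1) ?m)"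
    using reach_step[of count_tm "main_cfg w 3 (int i) (int ?n) (int ?k) ?m"]
    by (subst (asm) step_scan) simp
  have 4: "reach count_tm (Suc ?n) (main_cfg w 6 (int i) (int ?n - 1) (int ?k - 1) ?m) (main_cfg w 7 (int i) 0 (int ?k - 1) ?m)"
    by (rule count_tm_rewind_copy[OF assms(1)]) simp
  have 5: "reach count_tm (Suc ?k) (main_cfg w 7 (int i) 0 (int ?k - 1) ?m) (main_cfg w 2 (int i + 1) 0 0 ?m)"
    by (rule count_tm_rewind_counter) simp
  have "?k \<le> ?n" by (rule field_count_le)
  then have le: "1 + ?n * (2 * ?n + 5) + 1 + Suc ?n + Suc ?k \<le> ?n * (2 * ?n + 5) + 2 * ?n + 4" by simp
  show ?thesis
    using reach_mono[OF reach_trans[OF reach_trans[OF reach_trans[OF reach_trans[OF 1 2] 3] 4] 5] le]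
    by (simp add: add.commute)
qed

text \<open>Every cell is charged a full inner loop, separator or not; m accumulates the maximum
  over the cells already passed.\<close>

lemma count_tm_seek:
  assumes "0 \<notin> set w"
  shows "i \<le> length w \<Longrightarrow>
    reach count_tm (1 + (length w - i) * (length w * (2 * length w + 5) + 2 * length w + 4))
      (main_cfg w 2 (int i) 0 0 m)
      (main_cfg w 8 (int (length w)) 0 0 (max m (max_count w (drop i w))))"
proof (induction "length w - i" arbitrary: i m)
  case 0
  then show ?case
    by (simp, intro reach_Suc, subst step_seek) (simp add: reach_refl)
next
  case (Suc x)
  define B where "B = length w * (2 * length w + 5) + 2 * length w + 4"
  have i: "i < length w" using Suc by simp
  define m' where "m' = max m (if w ! i = 4 then field_count (drop (Suc i) w) w else 0)"
  have 1: "reach count_tm B (main_cfg w 2 (int i) 0 0 m) (main_cfg w 2 (int (Suc i)) 0 0 m')"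
  proof (cases "w ! i = 4")
    case True
    then show ?thesis using count_tm_outer_pass[OF assms i True] by (simp add: B_def m'_def)
  next
    case False
    have "w ! i \<noteq> 0" using assms i nth_mem by metis
    have "reach count_tm (Suc 0) (main_cfg w 2 (int i) 0 0 m) (main_cfg w 2 (int (Suc i)) 0 0 m')"
      by (rule reach_Suc, subst step_seek)
        (use False i \<open>w ! i \<noteq> 0\<close> in \<open>simp add: m'_def reach_refl add.commute\<close>)
    then show ?thesis by (rule reach_mono) (simp add: B_def)
  qed
  have "x = length w - Suc i" "Suc i \<le> length w" using Suc.hyps(2) by auto
  from Suc.hyps(1)[OF this, of m']
  have 2: "reach count_tm (1 + (length w - Suc i) * B) (main_cfg w 2 (int (Suc i)) 0 0 m')
     (main_cfg w 8 (int (length w)) 0 0 (max m' (max_count w (drop (Suc i) w))))" by (simp add: B_def)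
  have e: "max m' (max_count w (drop (Suc i) w)) = max m (max_count w (drop i w))"
    using i by (auto simp: m'_def max.assoc simp flip: Cons_nth_drop_Suc)
  have le: "B + (1 + (length w - Suc i) * B) \<le> 1 + (length w - i) * B"
    using i by (simp add: Suc_diff_Suc[symmetric])
  show ?case using reach_mono[OF reach_trans[OF 1 2[unfolded e]] le] by (simp add: B_def)
qed

lemma count_tm_copy:
  assumes "0 \<notin> set w"
  shows "i \<le> length w \<Longrightarrow> reach count_tm (Suc (length w - i))
    (0, [(word_cells w, int i), (word_cells [], 0), (word_cells (take i w), int i), (word_cells [], 0)])
    (main_cfg w 1 (int (length w) - 1) (int (length w) - 1) 0 0)"
proof (induction "length w - i" arbitrary: i)
  case 0
  then show ?case
    by (intro reach_Suc, subst step_copy) (simp add: reach_refl)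
next
  case (Suc x)
  have i: "i < length w" using Suc by simp
  have "w ! i \<noteq> 0" using assms i nth_mem by metis
  have u: "(word_cells (take i w))(int i := w ! i) = word_cells (take (Suc i) w)"
    using word_cells_append_upd[of "take i w" "[]" "w ! i"] i by (simp add: take_Suc_conv_app_nth)
  have "x = length w - Suc i" "Suc i \<le> length w" using Suc.hyps(2) by auto
  note IH = Suc.hyps(1)[OF this]
  have "reach count_tm (Suc (Suc (length w - Suc i)))
    (0, [(word_cells w, int i), (word_cells [], 0), (word_cells (take i w), int i), (word_cells [], 0)])
    (main_cfg w 1 (int (length w) - 1) (int (length w) - 1) 0 0)"
    by (rule reach_Suc, subst step_copy) (use i \<open>w ! i \<noteq> 0\<close> IH in \<open>simp add: u add.commute\<close>)
  then show ?case using i by (simp add: Suc_diff_Suc)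
qed

lemma count_tm_rewind_both:
  assumes "0 \<notin> set w"
  shows "j \<le> length w \<Longrightarrow> reach count_tm (Suc j) (main_cfg w 1 (int j - 1) (int j - 1) c m) (main_cfg w 2 0 0 c m)"
proof (induction j)
  case 0
  show ?case by (rule reach_Suc, subst step_rewind_both) (simp add: reach_refl)
next
  case (Suc j)
  then have "w ! j \<noteq> 0" using assms by (metis Suc_le_lessD nth_mem)
  show ?case
    by (rule reach_Suc, subst step_rewind_both) (use Suc \<open>w ! j \<noteq> 0\<close> in simp)
qed

section \<open>From the unary counter to binary output\<close>

fun binary_inc :: "nat list \<Rightarrow> nat list" where
  "binary_inc [] = [2]"
| "binary_inc (x # v) = (if x = 2 then 1 # binary_inc v else 2 # v)"

lemma binary_inc_binary: "binary_inc (binary k) = binary (Suc k)"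
proof (induction k rule: less_induct)
  case (less k)
  show ?case
  proof (cases "k = 0")
    case True
    then show ?thesis by (simp add: binary.simps)
  next
    case False
    then have b: "binary k = (k mod 2 + 1) # binary (k div 2)" by (subst binary.simps) simp
    have s: "binary (Suc k) = (Suc k mod 2 + 1) # binary (Suc k div 2)" by (subst binary.simps) simp
    show ?thesis
    proof (cases "even k")
      case True
      then show ?thesis by (simp add: b s even_iff_mod_2_eq_zero mod_Suc)
    next
      case odd: False
      then have "Suc k div 2 = Suc (k div 2)" by (meson even_Suc_div_two odd_Suc_div_two)
      moreover have "binary_inc (binary (k div 2)) = binary (Suc (k div 2))" using less False by simp
      ultimately show ?thesis using odd by (simp add: b s odd_iff_mod_2_eq_one)
    qed
  qed
qed

lemma length_binary: "length (binary k) \<le> k"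
proof (induction k)
  case 0
  show ?case by (simp add: binary.simps)
next
  case (Suc k)
  have "length (binary_inc v) \<le> Suc (length v)" for v by (induction v) auto
  from this[of "binary k"] Suc show ?case by (simp add: binary_inc_binary)
qed

lemma set_binary: "set (binary k) \<subseteq> {1, 2}"
proof (induction k rule: less_induct)
  case (less k)
  show ?case
    by (subst binary.simps) (use less[of "k div 2"] in auto)
qed

abbreviation out_cfg :: "nat list \<Rightarrow> nat \<Rightarrow> nat list \<Rightarrow> int \<Rightarrow> int \<Rightarrow> nat \<Rightarrow> config" where
  "out_cfg w q v b c m \<equiv>
     (q, [(word_cells w, int (length w)), (word_cells v, b), (word_cells w, 0), (word_cells (replicate m 1), c)])"

text \<open>In the induction u collects the digits that the carry has cleared; it runs to the right
  because the least significant digit comes first. The length h of its run bounds the way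
  back.\<close>

lemma count_tm_increment:
  "\<exists>h. h \<le> length v \<and> reach count_tm (Suc (length v)) (out_cfg w 9 (u @ v) (int (length u)) c m)
    (out_cfg w 10 (u @ binary_inc v) (int (length u + h) - 1) c m)"
proof (induction v arbitrary: u)
  case Nil
  show ?case
    by (intro exI[of _ 0] conjI, simp, rule reach_Suc, subst step_increment)
      (use word_cells_append_upd[of u "[]" 2] in \<open>simp add: reach_refl\<close>)
next
  case (Cons x v)
  show ?case
  proof (cases "x = 2")
    case False
    show ?thesis
      by (intro exI[of _ 0] conjI, simp, rule reach_Suc, subst step_increment)
        (use False word_cells_append_upd[of u "x # v" 2] in \<open>simp add: reach_refl\<close>)
  next
    case True
    from Cons[of "u @ [1]"] obtain h where h: "h \<le> length v"
      "reach count_tm (Suc (length v)) (out_cfg w 9 (u @ 1 # v) (int (Suc (length u))) c m)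
        (out_cfg w 10 (u @ 1 # binary_inc v) (int (length u + Suc h) - 1) c m)" by auto
    show ?thesis
      by (intro exI[of _ "Suc h"] conjI, (use h in simp)[1], rule reach_Suc, subst step_increment)
        (use True h(2) word_cells_append_upd[of u "x # v" 1] in \<open>simp add: add.commute\<close>)
  qed
qed

lemma count_tm_rewind_output:
  assumes "0 \<notin> set v"
  shows "j \<le> length v \<Longrightarrow> reach count_tm (Suc j) (out_cfg w 10 v (int j - 1) c m) (out_cfg w 8 v 0 c m)"
proof (induction j)
  case 0
  show ?case by (rule reach_Suc, subst step_rewind_output) (simp add: reach_refl)
next
  case (Suc j)
  then have "v ! j \<noteq> 0" using assms by (metis Suc_le_lessD nth_mem)
  show ?case
    by (rule reach_Suc, subst step_rewind_output) (use Suc \<open>v ! j \<noteq> 0\<close> in simp)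
qed

lemma length_binary_inc: "length v \<le> length (binary_inc v)"
  by (induction v) auto

text \<open>After k ones have been consumed, tape 1 holds k in binary. The crude bound k on its
  number of digits is enough for rounds of at most 2 m + 3 steps.\<close>

lemma count_tm_convert:
  "k \<le> m \<Longrightarrow> reach count_tm (1 + (m - k) * (2 * m + 3)) (out_cfg w 8 (binary k) 0 (int k) m)
     (out_cfg w 11 (binary m) 0 (int m) m)"
proof (induction "m - k" arbitrary: k)
  case 0
  then show ?case
    by (simp, intro reach_Suc, subst step_convert) (simp add: reach_refl)
next
  case (Suc x)
  have k: "k < m" using Suc.hyps by simp
  have 1: "reach count_tm 1 (out_cfg w 8 (binary k) 0 (int k) m) (out_cfg w 9 (binary k) 0 (int (Suc k)) m)"
    using reach_step[of count_tm "out_cfg w 8 (binary k) 0 (int k) m"] k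
    by (subst (asm) step_convert) (simp add: add.commute)
  from count_tm_increment[of "binary k" w "[]"] obtain h where h: "h \<le> length (binary k)"
    "reach count_tm (Suc (length (binary k))) (out_cfg w 9 (binary k) 0 (int (Suc k)) m)
      (out_cfg w 10 (binary (Suc k)) (int h - 1) (int (Suc k)) m)" by (auto simp: binary_inc_binary)
  have "0 \<notin> set (binary (Suc k))" using set_binary[of "Suc k"] by auto
  moreover have "h \<le> length (binary (Suc k))" using h(1) length_binary_inc[of "binary k"] by (simp add: binary_inc_binary)
  ultimately have 2: "reach count_tm (Suc h) (out_cfg w 10 (binary (Suc k)) (int h - 1) (int (Suc k)) m)
     (out_cfg w 8 (binary (Suc k)) 0 (int (Suc k)) m)" by (rule count_tm_rewind_output)
  have "x = m - Suc k" "Suc k \<le> m" using Suc.hyps(2) by auto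
  note 3 = Suc.hyps(1)[OF this]
  have "length (binary k) \<le> k" by (rule length_binary)
  then have le: "1 + Suc (length (binary k)) + Suc h + (1 + (m - Suc k) * (2 * m + 3)) \<le> 1 + (m - k) * (2 * m + 3)"
    using k h(1) by (simp add: Suc_diff_Suc[symmetric])
  show ?case using reach_mono[OF reach_trans[OF reach_trans[OF reach_trans[OF 1 h(2)] 2] 3] le] .
qed

text \<open>The left side is at most 2 n^3 + 9 n^2 + 9 n + 4, so the constant 20 is generous in
  every coefficient.\<close>

lemma count_tm_time_bound:
  fixes n :: nat
  assumes "m \<le> n"
  shows "Suc n + Suc n + (1 + n * (n * (2 * n + 5) + 2 * n + 4)) + (1 + m * (2 * m + 3)) \<le> 20 * (1 + n) ^ 3"
proof -
  have "m * (2 * m + 3) \<le> n * (2 * n + 3)" using assms by (intro mult_mono) auto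
  then show ?thesis by (simp add: power3_eq_cube algebra_simps)
qed

lemma count_tm_outputs:
  assumes "0 \<notin> set w"
  shows "outputs_within count_tm w (binary (max_count w w)) (20 * (1 + length w) ^ 3)"
proof -
  let ?n = "length w" and ?m = "max_count w w"
  have s: "start_config count_tm w =
    (0, [(word_cells w, 0), (word_cells [], 0), (word_cells [], 0), (word_cells [], 0)])"
    by (simp add: start_config_def numeral_eq_Suc)
  have 1: "reach count_tm (Suc ?n) (start_config count_tm w) (main_cfg w 1 (int ?n - 1) (int ?n - 1) 0 0)"
    using count_tm_copy[OF assms, of 0] by (simp add: s)
  have 2: "reach count_tm (Suc ?n) (main_cfg w 1 (int ?n - 1) (int ?n - 1) 0 0) (main_cfg w 2 0 0 0 0)"
    by (rule count_tm_rewind_both[OF assms]) simp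
  have 3: "reach count_tm (1 + ?n * (?n * (2 * ?n + 5) + 2 * ?n + 4)) (main_cfg w 2 0 0 0 0)
     (main_cfg w 8 (int ?n) 0 0 ?m)"
    using count_tm_seek[OF assms, of 0 0] by simp
  have 4: "reach count_tm (1 + ?m * (2 * ?m + 3)) (main_cfg w 8 (int ?n) 0 0 ?m) (out_cfg w 11 (binary ?m) 0 (int ?m) ?m)"
    using count_tm_convert[of 0 ?m w] by (simp add: binary.simps[of 0])
  have "reach count_tm (20 * (1 + ?n) ^ 3) (start_config count_tm w) (out_cfg w 11 (binary ?m) 0 (int ?m) ?m)"
    using reach_mono[OF reach_trans[OF reach_trans[OF reach_trans[OF 1 2] 3] 4] count_tm_time_bound[OF max_count_le]] .
  then show ?thesis
    unfolding outputs_within_def reach_def by force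
qed

section \<open>Computing \<open>ell\<close> from the encoding\<close>

lemma binary_inject: "binary m = binary n \<Longrightarrow> m = n"
proof (induction m arbitrary: n rule: less_induct)
  case (less m)
  show ?case
  proof (cases "m = 0 \<or> n = 0")
    case True
    with less.prems show ?thesis by (auto simp: binary.simps[of m] binary.simps[of n] split: if_splits)
  next
    case False
    with less.prems have "m mod 2 = n mod 2" "binary (m div 2) = binary (n div 2)"
      by (simp_all add: binary.simps[of m] binary.simps[of n])
    with less.IH[of "m div 2"] False show ?thesis by (metis div_less_dividend div_mult_mod_eq not_gr_zero one_less_numeral_iff semiring_norm(76))
  qed
qed

text \<open>The closing 3 is no digit, so a comparison succeeds only if both strings end together;
  the texts behind it are never read.\<close>

lemma same_field_append:
  assumes "set d \<subseteq> {1, 2}" "set d' \<subseteq> {1, 2}"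
  shows "same_field (d @ 3 # u) (d' @ 3 # v) \<longleftrightarrow> d = d'"
  using assms
proof (induction d arbitrary: d')
  case Nil
  then show ?case by (cases d') auto
next
  case (Cons x d)
  then show ?case by (cases d') auto
qed

lemma not_same_field_sep: "\<not> same_field u (5 # v)" "\<not> same_field (5 # u) v"
  by (cases u; simp) (cases v; simp)


lemma field_count_skip: "4 \<notin> set v \<Longrightarrow> field_count u (v @ v') = field_count u v'"
  by (induction v) auto

lemma max_count_skip: "4 \<notin> set v \<Longrightarrow> max_count w (v @ v') = max_count w v'"
  by (induction v) auto

lemma set_binary_notin: "4 \<notin> set (binary k)" "4 \<notin> set (binary k @ [3] @ binary l)"
  using set_binary[of k] set_binary[of l] by auto

abbreviation encode_factors :: "(nat \<times> nat) list \<Rightarrow> nat list" where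
  "encode_factors fs \<equiv> concat (map (\<lambda>(p, e). binary p @ [3] @ binary e @ [4]) fs)"

lemma encode_instance_Cons:
  "encode_instance ((a, fs) # xs) = binary a @ 4 # encode_factors fs @ 5 # encode_instance xs"
  by (simp add: encode_instance_def encode_entry_def)

text \<open>In the encoding only primes and the closing 5 follow a 4, so neither entries nor
  exponents are ever compared as fields.\<close>

lemma field_count_factors:
  "field_count (binary p @ 3 # u) (4 # encode_factors fs @ 5 # v) =
     count_list (map fst fs) p + field_count (binary p @ 3 # u) v"
proof (induction fs)
  case Nil
  show ?case by (simp add: not_same_field_sep)
next
  case (Cons f fs)
  obtain q e where f: "f = (q, e)" by (cases f)
  have "same_field (binary p @ 3 # u) (binary q @ 3 # x) \<longleftrightarrow> p = q" for x
    by (subst same_field_append) (use set_binary binary_inject in auto)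
  then show ?case
    using Cons field_count_skip[OF set_binary_notin(2)[of q e], of "binary p @ 3 # u" "4 # encode_factors fs @ 5 # v"]
    by (simp add: f)
qed

lemma field_count_encode:
  "field_count (binary p @ 3 # u) (encode_instance xs) = (\<Sum>(a, fs)\<leftarrow>xs. count_list (map fst fs) p)"
proof (induction xs)
  case Nil
  show ?case by (simp add: encode_instance_def)
next
  case (Cons x xs)
  obtain a fs where x: "x = (a, fs)" by (cases x)
  show ?case
    using field_count_skip[OF set_binary_notin(1)[of a]] field_count_factors[of p u fs "encode_instance xs"] Cons
    by (simp only: x encode_instance_Cons) simp
qed

lemma field_count_sep: "field_count (5 # u) v = 0"
  by (induction v) (auto simp: not_same_field_sep)

text \<open>The hypothesis says that the count belongs to the prime alone, whatever text u follows
  it; the outer loop thus takes a maximum over primes.\<close>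

lemma max_count_factors:
  assumes "\<And>p u. field_count (binary p @ 3 # u) w = C p"
  shows "max_count w (4 # encode_factors fs @ 5 # v) = foldr (max \<circ> C \<circ> fst) fs (max_count w v)"
proof (induction fs)
  case Nil
  show ?case by (simp add: field_count_sep)
next
  case (Cons f fs)
  obtain q e where f: "f = (q, e)" by (cases f)
  show ?case
    using Cons max_count_skip[OF set_binary_notin(2)[of q e], of w "4 # encode_factors fs @ 5 # v"]
    by (simp add: f assms)
qed

lemma foldr_max: "foldr (max \<circ> g) xs (b::nat) = Max (insert b (g ` set xs))"
proof (induction xs)
  case (Cons x xs)
  have "Max (insert b (g ` set (x # xs))) = Max (insert (g x) (insert b (g ` set xs)))"
    by (simp add: insert_commute)
  also have "\<dots> = max (g x) (Max (insert b (g ` set xs)))"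
    by (rule Max_insert) auto
  finally show ?case using Cons by simp
qed simp

lemma max_count_encode:
  assumes "\<And>p u. field_count (binary p @ 3 # u) w = C p"
  shows "max_count w (encode_instance xs) = Max (insert 0 (C ` (\<Union>x\<in>set xs. fst ` set (snd x))))"
proof (induction xs)
  case Nil
  show ?case by (simp add: encode_instance_def)
next
  case (Cons x xs)
  obtain a fs where x: "x = (a, fs)" by (cases x)
  let ?S = "insert 0 (C ` (\<Union>x\<in>set xs. fst ` set (snd x)))"
  have fin: "finite ?S" by auto
  have "max_count w (encode_instance (x # xs)) = max_count w (4 # encode_factors fs @ 5 # encode_instance xs)"
    by (simp only: x encode_instance_Cons max_count_skip[OF set_binary_notin(1)])
  also have "\<dots> = foldr (max \<circ> (C \<circ> fst)) fs (max_count w (encode_instance xs))"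
    by (simp only: max_count_factors[OF assms] comp_assoc)
  also have "\<dots> = Max (insert (Max ?S) ((C \<circ> fst) ` set fs))"
    by (simp only: foldr_max Cons)
  also have "\<dots> = Max (?S \<union> (C \<circ> fst) ` set fs)"
  proof (cases "fs = []")
    case False
    have "Max (insert (Max ?S) ((C \<circ> fst) ` set fs)) = max (Max ?S) (Max ((C \<circ> fst) ` set fs))"
      using False by (intro Max_insert) auto
    then show ?thesis using False fin by (subst Max_Un) auto
  qed simp
  also have "?S \<union> (C \<circ> fst) ` set fs = insert 0 (C ` (\<Union>x\<in>set (x # xs). fst ` set (snd x)))"
    by (auto simp: x image_image)
  finally show ?case .
qed

section \<open>Prime occurrences and divisibility of the entries\<close>

lemma prime_dvd_prod_list_iff:
  "prime p \<Longrightarrow> p dvd prod_list xs \<longleftrightarrow> (\<exists>x\<in>set xs. p dvd x)"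
  by (induction xs) (auto simp: prime_dvd_mult_iff)

lemma count_list_distinct: "distinct xs \<Longrightarrow> count_list xs x = (if x \<in> set xs then 1 else 0)"
  by (induction xs) auto

text \<open>The listed primes are distinct, so p occurs at most once, and exactly when it divides a.
  Summing over the entries therefore counts the multiples of p.\<close>

lemma count_list_factorization:
  assumes "factorization_of a fs" "prime p"
  shows "count_list (map fst fs) p = (if p dvd a then 1 else 0)"
proof -
  have "a = prod_list (map (\<lambda>(p, e). p ^ e) fs)"
    using assms by (simp add: factorization_of_def)
  then have dvd_iff: "p dvd a \<longleftrightarrow> (\<exists>x\<in>set fs. p dvd fst x ^ snd x)"
    using prime_dvd_prod_list_iff[OF assms(2), of "map (\<lambda>(p, e). p ^ e) fs"]
    by (simp add: case_prod_beta)
  have factor: "prime q" "0 < e" if "(q, e) \<in> set fs" for q e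
    using assms(1) that by (auto simp: factorization_of_def)
  have "p dvd q ^ e \<longleftrightarrow> p = q" if "(q, e) \<in> set fs" for q e
    using factor[OF that] assms(2) by (metis dvd_power prime_dvd_power primes_dvd_imp_eq)
  then have "p dvd a \<longleftrightarrow> p \<in> set (map fst fs)"
    unfolding dvd_iff by force
  then show ?thesis
    using assms by (simp add: factorization_of_def count_list_distinct)
qed

lemma card_indices_Cons:
  "card {i. i < length (x # xs) \<and> P ((x # xs) ! i)} = (if P x then 1 else 0) + card {i. i < length xs \<and> P (xs ! i)}"
proof -
  have "card {i. i < length ys \<and> P (ys ! i)} = length (filter P ys)" for ys
    by (simp add: length_filter_conv_card)
  from this[of "x # xs"] this[of xs] show ?thesis by (simp del: length_Cons)
qed

lemma max_count_eq_ell: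
  assumes "xs \<in> factored_instances"
  shows "max_count (encode_instance xs) (encode_instance xs) = ell (map fst xs)"
proof -
  define C where "C = (\<lambda>p. \<Sum>(a, fs)\<leftarrow>xs. count_list (map fst fs) p)"
  define D where "D = (\<lambda>p. card {i. i < length (map fst xs) \<and> p dvd map fst xs ! i})"
  let ?P = "\<Union>x\<in>set xs. fst ` set (snd x)"
  have adm: "admissible (map fst xs)" and fac: "\<And>a fs. (a, fs) \<in> set xs \<Longrightarrow> factorization_of a fs"
    using assms by (auto simp: factored_instances_def)
  have CD: "C p = D p" if "prime p" for p
    using fac unfolding C_def D_def
  proof (induction xs)
    case (Cons x xs)
    obtain a fs where x: "x = (a, fs)" by (cases x)
    from Cons.prems[of a fs] have "factorization_of a fs" by (simp add: x)
    with Cons count_list_factorization[OF _ that] show ?case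
      unfolding list.map card_indices_Cons by (simp add: x)
  qed simp
  have mc: "max_count (encode_instance xs) (encode_instance xs) = Max (insert 0 (C ` ?P))"
    by (rule max_count_encode) (simp add: C_def field_count_encode)
  have fin: "finite (insert 0 (C ` ?P))" by auto
  have pr: "prime p" if "p \<in> ?P" for p
    using that fac by (force simp: factorization_of_def)
  have "Max (insert 0 (C ` ?P)) \<le> ell (map fst xs)"
  proof (rule Max.boundedI[OF fin])
    fix k assume "k \<in> insert 0 (C ` ?P)"
    then consider "k = 0" | p where "p \<in> ?P" "k = C p" by blast
    then show "k \<le> ell (map fst xs)"
    proof cases
      case 2
      then show ?thesis using card_indices_le_ell[OF adm, of p] pr[of p] CD[of p]
        unfolding D_def by fastforce
    qed simp
  qed simp
  moreover obtain p where p: "prime p" "0 < ell (map fst xs)" "D p = ell (map fst xs)"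
    unfolding D_def using ell_eq_card_prime[OF adm] .
  \<comment> \<open>A prime attaining \<open>ell\<close> divides at least one entry because
    \<open>ell\<close> is positive, so some factorization lists it.\<close>
  have "p \<in> ?P"
  proof (rule ccontr)
    assume "p \<notin> ?P"
    then have "C p = 0" by (force simp: C_def sum_list_eq_0_iff count_list_0_iff)
    with p CD show False by simp
  qed
  then have "C p \<le> Max (insert 0 (C ` ?P))" by (intro Max_ge[OF fin]) auto
  ultimately show ?thesis using p(1,3) CD[of p] unfolding mc by linarith
qed

lemma set_encode_instance: "set (encode_instance xs) \<subseteq> {1..<6}"
proof -
  have "set (binary k) \<subseteq> {1..<6}" for k using set_binary[of k] by auto
  then show ?thesis by (fastforce simp: encode_instance_def encode_entry_def)
qed

lemma poly_time_ell:
  "poly_time_computable factored_instances encode_instance binary (\<lambda>xs. ell (map fst xs))"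
  unfolding poly_time_computable_def
proof (intro exI conjI ballI)
  show "wf_tm count_tm" by (rule wf_count_tm)
  fix xs assume xs: "xs \<in> factored_instances"
  show "set (encode_instance xs) \<subseteq> {1..<symbols count_tm}" using set_encode_instance by simp
  have "0 \<notin> set (encode_instance xs)" using set_encode_instance[of xs] by auto
  from count_tm_outputs[OF this] show "outputs_within count_tm (encode_instance xs) (binary (ell (map fst xs)))
      (poly ([:20:] * [:1, 1:] ^ 3) (length (encode_instance xs)))"
    by (simp add: max_count_eq_ell[OF xs] poly_power)
qed

theorem theorem1p2:
  "(\<forall>as. admissible as \<longrightarrow>
      (\<exists>E. denumerant_coeffs as E) \<and>
      (\<forall>E. denumerant_coeffs as E \<longrightarrow>
         (\<forall>m. ell as \<le> m \<and> m \<le> length as - 1 \<longrightarrow> constant_fun (E m)) \<and>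
         periodic (E (ell as - 1)) \<and> \<not> constant_fun (E (ell as - 1)))) \<and>
   poly_time_computable factored_instances encode_instance binary (\<lambda>xs. ell (map fst xs))"
proof (intro conjI allI impI)
  fix as assume as: "admissible as"
  then have "as \<noteq> []" "\<forall>a\<in>set as. 0 < a" by (auto simp: admissible_def)
  from denumerant_coeffs_Fourier[OF this] show "\<exists>E. denumerant_coeffs as E" by blast
  fix E assume E: "denumerant_coeffs as E"
  show "\<not> constant_fun (E (ell as - 1))" by (rule coefficient_ell_not_constant[OF as E])
  \<comment> \<open>Periodicity is asserted only up to degree \<open>length as - 1\<close>; that
    \<open>ell\<close> is a pole order bounds it by the length.\<close>
  obtain z where "pole_order z as = ell as" using pole_order_ell[OF as] by metis
  then have "ell as - 1 \<le> length as - 1" by (metis diff_le_mono length_filter_le pole_order_def)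
  then show "periodic (E (ell as - 1))" using E by (auto simp: denumerant_coeffs_def)
  fix m assume "ell as \<le> m \<and> m \<le> length as - 1"
  then show "constant_fun (E m)" using coefficient_constant[OF as E] by blast
qed (rule poly_time_ell)

end
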